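(* Let $G$ be a cyclically 6-edge-connected cubic graph. If $\omega(G) \leq 4$, where $\omega(G)$ denotes the oddness of $G$, then $G$ has a nowhere-zero 5-flow.
   Context: Graphs are finite. A graph is cubic if every vertex has degree 3. For $S \subseteq V(G)$, $\partial_G(S)$ denotes the set of edges of $G$ with precisely one end in $S$. Cyclic edge-connectivity (standard meaning): a graph $G$ is cyclically 6-edge-connected if there is no $S \subseteq V(G)$ with $|\partial_G(S)| < 6$ such that both induced subgraphs $G[S]$ and $G[V(G)\setminus S]$ contain a circuit (that is, no set of fewer than 6 edges separates two circuits of $G$). In particular, a cyclically 6-edge-connected cubic graph is connected and bridgeless. Oddness: a 2-factor of $G$ is a spanning 2-regular subgraph, i.e. a spanning subgraph whose components are circuits; a circuit is odd if it has an odd number of edges. Every bridgeless cubic graph has a 2-factor. The oddness $\omega(G)$ of a bridgeless cubic graph $G$ is the minimum number of odd circuits in a 2-factor of $G$, the minimum being taken over all 2-factors of $G$. Nowhere-zero flow: for an integer $k \geq 2$, a nowhere-zero $k$-flow on a graph $G$ is an assignment to each edge of $G$ of a direction and a value in $\{1, \dots, k-1\}$ such that Kirchhoff's law holds at every vertex $v$, i.e. the sum of the values of the edges directed out of $v$ equals the sum of the values of the edges directed into $v$. *)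

theory Defs
  imports Main
begin

text \<open>
  Graphs are undirected and may have parallel edges and loops. An edge \<open>e\<close> carries the set \<open>ends G e\<close>
  of its ends, which has two elements, or a single one if \<open>e\<close> is a loop.
\<close>

record ('v, 'e) multigraph =
  vertices :: "'v set"
  edges :: "'e set"
  ends :: "'e \<Rightarrow> 'v set"

locale fin_multigraph =
  fixes G :: "('v, 'e) multigraph"
  assumes finite_vertices: "finite (vertices G)"
    and finite_edges: "finite (edges G)"
    and ends_in_vertices: "e \<in> edges G \<Longrightarrow> ends G e \<subseteq> vertices G"
    and card_ends: "e \<in> edges G \<Longrightarrow> card (ends G e) \<in> {1, 2}"

text \<open>A loop contributes 2 to the degree of its end.\<close>

definition degree :: "('v, 'e) multigraph \<Rightarrow> 'v \<Rightarrow> nat" where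
  "degree G v = card {e \<in> edges G. v \<in> ends G e} + card {e \<in> edges G. ends G e = {v}}"

definition regular :: "nat \<Rightarrow> ('v, 'e) multigraph \<Rightarrow> bool" where
  "regular r G \<longleftrightarrow> (\<forall>v \<in> vertices G. degree G v = r)"

definition cubic :: "('v, 'e) multigraph \<Rightarrow> bool" where
  "cubic G \<longleftrightarrow> regular 3 G"

text \<open>
  The incidence function of a subgraph is required to be that of the whole graph, also outside the
  edge set. Hence a subgraph is determined by its vertices and edges, and subgraphs can be counted.
\<close>

definition subgraph :: "('v, 'e) multigraph \<Rightarrow> ('v, 'e) multigraph \<Rightarrow> bool" where
  "subgraph H G \<longleftrightarrow> vertices H \<subseteq> vertices G \<and> edges H \<subseteq> edges G \<and> ends H = ends G \<and>
     (\<forall>e \<in> edges H. ends H e \<subseteq> vertices H)"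

definition induced_subgraph :: "('v, 'e) multigraph \<Rightarrow> 'v set \<Rightarrow> ('v, 'e) multigraph" where
  "induced_subgraph G S = \<lparr>vertices = S, edges = {e \<in> edges G. ends G e \<subseteq> S}, ends = ends G\<rparr>"

definition edge_boundary :: "('v, 'e) multigraph \<Rightarrow> 'v set \<Rightarrow> 'e set" where
  "edge_boundary G S = {e \<in> edges G. \<exists>u v. ends G e = {u, v} \<and> u \<in> S \<and> v \<notin> S}"

definition connected_graph :: "('v, 'e) multigraph \<Rightarrow> bool" where
  "connected_graph G \<longleftrightarrow> vertices G \<noteq> {} \<and>
     (\<forall>u \<in> vertices G. \<forall>v \<in> vertices G. (u, v) \<in> {(x, y). \<exists>e \<in> edges G. ends G e = {x, y}}\<^sup>*)"

definition component :: "('v, 'e) multigraph \<Rightarrow> ('v, 'e) multigraph \<Rightarrow> bool" where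
  "component C G \<longleftrightarrow> subgraph C G \<and> connected_graph C \<and>
     (\<forall>D. subgraph D G \<and> connected_graph D \<and> subgraph C D \<longrightarrow> D = C)"

text \<open>A loop is a circuit of length 1, and two parallel edges form a circuit of length 2.\<close>

definition circuit :: "('v, 'e) multigraph \<Rightarrow> bool" where
  "circuit C \<longleftrightarrow> connected_graph C \<and> regular 2 C"

definition contains_circuit :: "('v, 'e) multigraph \<Rightarrow> bool" where
  "contains_circuit G \<longleftrightarrow> (\<exists>C. subgraph C G \<and> circuit C)"

definition cyclically_edge_connected :: "nat \<Rightarrow> ('v, 'e) multigraph \<Rightarrow> bool" where
  "cyclically_edge_connected k G \<longleftrightarrow>
     \<not> (\<exists>S \<subseteq> vertices G. card (edge_boundary G S) < k \<and>
          contains_circuit (induced_subgraph G S) \<and>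
          contains_circuit (induced_subgraph G (vertices G - S)))"

definition two_factor :: "('v, 'e) multigraph \<Rightarrow> ('v, 'e) multigraph \<Rightarrow> bool" where
  "two_factor F G \<longleftrightarrow> subgraph F G \<and> vertices F = vertices G \<and> regular 2 F"

definition odd_circuits :: "('v, 'e) multigraph \<Rightarrow> ('v, 'e) multigraph set" where
  "odd_circuits F = {C. component C F \<and> circuit C \<and> odd (card (edges C))}"

text \<open>Unspecified if \<open>G\<close> has no 2-factor; every bridgeless cubic graph has one.\<close>

definition oddness :: "('v, 'e) multigraph \<Rightarrow> nat" where
  "oddness G = (LEAST n. \<exists>F. two_factor F G \<and> n = card (odd_circuits F))"

text \<open>Edge \<open>e\<close> is directed from \<open>t e\<close> to \<open>h e\<close> and has value \<open>f e\<close>.\<close>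

definition nowhere_zero_flow ::
  "nat \<Rightarrow> ('v, 'e) multigraph \<Rightarrow> ('e \<Rightarrow> 'v) \<Rightarrow> ('e \<Rightarrow> 'v) \<Rightarrow> ('e \<Rightarrow> nat) \<Rightarrow> bool" where
  "nowhere_zero_flow k G t h f \<longleftrightarrow>
     (\<forall>e \<in> edges G. ends G e = {t e, h e} \<and> f e \<in> {1..k - 1}) \<and>
     (\<forall>v \<in> vertices G. (\<Sum>e | e \<in> edges G \<and> t e = v. f e) = (\<Sum>e | e \<in> edges G \<and> h e = v. f e))"

definition has_nowhere_zero_flow :: "nat \<Rightarrow> ('v, 'e) multigraph \<Rightarrow> bool" where
  "has_nowhere_zero_flow k G \<longleftrightarrow> (\<exists>t h f. nowhere_zero_flow k G t h f)"

end

theory Submission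
  imports Defs
begin

text \<open>
  For a cubic graph \<open>G\<close> it suffices to find a signing \<open>w\<close> of the vertices by \<open>1\<close> and \<open>-1\<close> with
  \<open>5 |w(X)| \<le> 3 |\<partial>X|\<close> for all \<open>X\<close> (a balanced valuation): orient the circuits of a 2-factor \<open>F\<close>
  cyclically and each edge of the complementary perfect matching \<open>M\<close> from sign \<open>-1\<close> to sign \<open>1\<close>;
  the inequality then says that \<open>X\<close> has at most four times as many entering as leaving edges,
  and Hoffman's circulation theorem gives a flow with values in \<open>{1..4}\<close>.

  Choose \<open>F\<close> with at most four odd circuits, and a matching \<open>N\<^sub>2 \<subseteq> F\<close> missing exactly one vertex of
  each odd circuit; let \<open>N\<^sub>3 = F - N\<^sub>2\<close> and let \<open>Y\<close> be the set of missed vertices. Pair the elements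
  of \<open>Y\<close> arbitrarily. The union of \<open>M\<close>, \<open>N\<^sub>2\<close> and the pairs is bipartite, hence has a signing alternating
  along all of them. It satisfies \<open>w(X) \<le> d\<^sub>M(X)\<close> and \<open>w(X) \<le> d\<^sub>2(X) + w(X \<inter> Y)\<close>, where
  \<open>w(X \<inter> Y) \<le> 2\<close>. By parity and connectivity, the signing is balanced unless there is a critical \<open>X\<close>,
  one with \<open>d\<^sub>M(X) = 4\<close>, \<open>d\<^sub>2(X) = 2\<close>, \<open>d\<^sub>3(X) = 0\<close> which separates both pairs of \<open>Y\<close>.
  If this happens for some pairing, use the pairing given by the two sides of \<open>X\<close>. A critical set
  \<open>X'\<close> for the second pairing and \<open>X\<close> cut the graph into four cells with one element of \<open>Y\<close> and an odd
  number of boundary edges each. By submodularity two adjacent cells have at most 5 boundary edges.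
  Cyclic 6-edge-connectivity forces such a cell to be a path with three vertices, centred at its
  element of \<open>Y\<close>. But then the union of the two cells has \<open>d\<^sub>2 = 4\<close>, although it is
  \<open>X\<close>, \<open>X'\<close> or the complement of one of them.
\<close>

section \<open>Integral flows with prescribed excess\<close>

definition net :: "'e set \<Rightarrow> ('e \<Rightarrow> 'v) \<Rightarrow> ('e \<Rightarrow> 'v) \<Rightarrow> ('e \<Rightarrow> int) \<Rightarrow> 'v \<Rightarrow> int" where
  "net E t h f v = (\<Sum>e | e \<in> E \<and> t e = v. f e) - (\<Sum>e | e \<in> E \<and> h e = v. f e)"

lemma net_alt:
  assumes "finite E"
  shows "net E t h f v = (\<Sum>e\<in>E. (if t e = v then f e else 0) - (if h e = v then f e else 0))"
proof -
  have "(\<Sum>e | e \<in> E \<and> g e = v. f e) = (\<Sum>e\<in>E. if g e = v then f e else 0)" for g :: "'a \<Rightarrow> 'b"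
    using assms by (simp add: sum.If_cases Collect_conj_eq)
  then show ?thesis
    by (simp add: net_def sum_subtractf)
qed

lemma net_upd:
  assumes "finite E" "e \<in> E"
  shows "net E t h (f(e := f e + c)) v
    = net E t h f v + (if t e = v then c else 0) - (if h e = v then c else 0)"
proof -
  have *: "(\<Sum>x\<in>E. (if g x = v then (f(e := f e + c)) x else 0))
      = (\<Sum>x\<in>E. if g x = v then f x else 0) + (if g e = v then c else 0)" for g :: "'a \<Rightarrow> 'b"
  proof -
    have "(\<Sum>x\<in>E. (if g x = v then (f(e := f e + c)) x else 0))
      = (\<Sum>x\<in>E. (if g x = v then f x else 0) + (if x = e \<and> g e = v then c else 0))"
      by (rule sum.cong) auto
    then show ?thesis
      using assms by (simp add: sum.distrib)
  qed
  show ?thesis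
    using assms(1) by (simp add: net_alt sum_subtractf *)
qed

lemma sum_net:
  assumes "finite E" "finite X"
  shows "(\<Sum>v\<in>X. net E t h f v)
    = (\<Sum>e | e \<in> E \<and> t e \<in> X \<and> h e \<notin> X. f e) - (\<Sum>e | e \<in> E \<and> h e \<in> X \<and> t e \<notin> X. f e)"
proof -
  have "(\<Sum>v\<in>X. net E t h f v)
      = (\<Sum>e\<in>E. \<Sum>v\<in>X. (if t e = v then f e else 0) - (if h e = v then f e else 0))"
    by (simp add: net_alt assms(1)) (rule sum.swap)
  also have "\<dots> = (\<Sum>e\<in>E. (if t e \<in> X then f e else 0) - (if h e \<in> X then f e else 0))"
    using assms(2) by (simp add: sum_subtractf)
  also have "\<dots> = (\<Sum>e\<in>E. (if t e \<in> X \<and> h e \<notin> X then f e else 0)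
      - (if h e \<in> X \<and> t e \<notin> X then f e else 0))"
    by (rule sum.cong) auto
  also have "\<dots> = (\<Sum>e | e \<in> E \<and> t e \<in> X \<and> h e \<notin> X. f e) - (\<Sum>e | e \<in> E \<and> h e \<in> X \<and> t e \<notin> X. f e)"
    using assms(1) by (simp add: sum_subtractf sum.If_cases Collect_conj_eq)
  finally show ?thesis .
qed

definition feasible :: "'e set \<Rightarrow> ('e \<Rightarrow> int) \<Rightarrow> ('e \<Rightarrow> int) \<Rightarrow> ('e \<Rightarrow> int) \<Rightarrow> bool" where
  "feasible E l u f \<longleftrightarrow> (\<forall>e\<in>E. l e \<le> f e \<and> f e \<le> u e)"

text \<open>
  The vertices of \<open>X\<close> are those to which a unit can be sent from \<open>v\<close> by changing \<open>f\<close> inside \<open>X\<close>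
  only. This makes \<open>X\<close> extensible by one residual edge at a time, without reference to paths.
\<close>

lemma residual_closure:
  fixes f :: "'e \<Rightarrow> int" and t h :: "'e \<Rightarrow> 'v"
  assumes fin: "finite V" "finite E" and th: "t ` E \<subseteq> V" "h ` E \<subseteq> V"
    and f: "feasible E l u f" and v: "v \<in> V"
  obtains X where "X \<subseteq> V" "v \<in> X"
    "\<And>x. x \<in> X \<Longrightarrow> \<exists>f'. feasible E l u f' \<and> (\<forall>y. net E t h f' y
        = net E t h f y + (if y = v then 1 else 0) - (if y = x then 1 else 0))"
    "\<And>e. e \<in> E \<Longrightarrow> t e \<in> X \<Longrightarrow> h e \<notin> X \<Longrightarrow> f e = u e"
    "\<And>e. e \<in> E \<Longrightarrow> h e \<in> X \<Longrightarrow> t e \<notin> X \<Longrightarrow> f e = l e"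
proof -
  define sent where "sent x f' \<longleftrightarrow> (\<forall>y. net E t h f' y
        = net E t h f y + (if y = v then 1 else 0) - (if y = x then 1 else 0))" for x f'
  define P where "P X \<longleftrightarrow> X \<subseteq> V \<and> v \<in> X \<and> (\<forall>x\<in>X. \<exists>f'. feasible E l u f' \<and> sent x f' \<and>
      (\<forall>e\<in>E. t e \<in> X \<and> h e \<in> X \<or> f' e = f e))" for X
  have "P {v}"
    unfolding P_def using v f by (auto simp: sent_def intro!: exI[of _ f])
  moreover have "finite {X. P X}"
    by (rule finite_subset[of _ "Pow V"]) (use fin in \<open>auto simp: P_def\<close>)
  ultimately obtain X where X: "P X" and max: "\<And>Z. P Z \<Longrightarrow> X \<subseteq> Z \<Longrightarrow> X = Z"
    using finite_has_maximal[of "{X. P X}"] by auto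
  \<comment> \<open>\<open>c\<close> is the unit pushed along \<open>e\<close>: 1 in the direction
    of \<open>e\<close>, -1 against it. Residual capacity in either case would let \<open>z\<close>
    join the maximal set \<open>X\<close>.\<close>
  have extend: False
    if e: "e \<in> E" and x: "x \<in> X" "z \<in> V" "z \<notin> X" "t e = x \<and> h e = z \<and> c = 1 \<or> h e = x \<and> t e = z \<and> c = - 1"
      and c: "l e \<le> f e + c" "f e + c \<le> u e" for e x z c
  proof -
    have "P (insert z X)"
      unfolding P_def
    proof (intro conjI ballI)
      show "insert z X \<subseteq> V" "v \<in> insert z X"
        using X x by (auto simp: P_def)
      fix y assume y: "y \<in> insert z X"
      show "\<exists>f'. feasible E l u f' \<and> sent y f' \<and>
          (\<forall>e\<in>E. t e \<in> insert z X \<and> h e \<in> insert z X \<or> f' e = f e)"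
      proof (cases "y = z")
        case False
        then show ?thesis using X y unfolding P_def by blast
      next
        case True
        obtain f' where f': "feasible E l u f'" "sent x f'"
            "\<forall>e\<in>E. t e \<in> X \<and> h e \<in> X \<or> f' e = f e"
          using X x(1) unfolding P_def by blast
        have "f' e = f e"
          using f'(3) e x by blast
        then have "feasible E l u (f'(e := f' e + c))"
          using f'(1) c by (auto simp: feasible_def)
        moreover have "sent z (f'(e := f' e + c))"
          using f'(2) x e fin(2) by (auto simp: sent_def net_upd simp del: fun_upd_apply)
        moreover have "\<forall>e'\<in>E. t e' \<in> insert z X \<and> h e' \<in> insert z X \<or> (f'(e := f' e + c)) e' = f e'"
          using f'(3) x(1,4) by auto
        ultimately show ?thesis
          using True by blast
      qed
    qed
    then show False
      using max x(3) by blast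
  qed
  show thesis
  proof (rule that)
    show "X \<subseteq> V" "v \<in> X"
      using X by (auto simp: P_def)
    show "\<exists>f'. feasible E l u f' \<and> (\<forall>y. net E t h f' y
        = net E t h f y + (if y = v then 1 else 0) - (if y = x then 1 else 0))" if "x \<in> X" for x
      using X that unfolding P_def sent_def by blast
    show "f e = u e" if "e \<in> E" "t e \<in> X" "h e \<notin> X" for e
      using extend[of e "t e" "h e" 1] that th f by (force simp: feasible_def)
    show "f e = l e" if "e \<in> E" "h e \<in> X" "t e \<notin> X" for e
      using extend[of e "h e" "t e" "- 1"] that th f by (force simp: feasible_def)
  qed
qed

text \<open>Hoffman's circulation theorem with demands \<open>b\<close>. Take a feasible
  \<open>f\<close> of least total deviation from \<open>b\<close>, a vertex \<open>v\<close> with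
  too small a net outflow, and the residual closure \<open>X\<close> of \<open>v\<close>. By
  minimality no vertex of \<open>X\<close> has too large a net outflow, while the edges leaving and
  entering \<open>X\<close> are at their bounds, so the cut condition fails at
  \<open>X\<close>.\<close>

theorem integral_flow_exists:
  fixes b :: "'v \<Rightarrow> int" and t h :: "'e \<Rightarrow> 'v" and l u :: "'e \<Rightarrow> int"
  assumes fin: "finite V" "finite E" and th: "t ` E \<subseteq> V" "h ` E \<subseteq> V"
    and lu: "\<And>e. e \<in> E \<Longrightarrow> l e \<le> u e" and b: "(\<Sum>v\<in>V. b v) = 0"
    and cut: "\<And>X. X \<subseteq> V \<Longrightarrow> (\<Sum>v\<in>X. b v)
      \<le> (\<Sum>e | e \<in> E \<and> t e \<in> X \<and> h e \<notin> X. u e) - (\<Sum>e | e \<in> E \<and> h e \<in> X \<and> t e \<notin> X. l e)"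
  obtains f where "feasible E l u f" "\<And>v. v \<in> V \<Longrightarrow> net E t h f v = b v"
proof -
  define D where "D f = nat (\<Sum>v\<in>V. \<bar>b v - net E t h f v\<bar>)" for f
  have "feasible E l u l"
    using lu by (auto simp: feasible_def)
  then obtain f where f: "feasible E l u f" and min: "\<And>g. feasible E l u g \<Longrightarrow> D f \<le> D g"
    using ex_has_least_nat[of "feasible E l u" l D] by blast
  have "(\<Sum>v\<in>V. net E t h f v) = 0"
  proof -
    have "{e \<in> E. t e \<in> V \<and> h e \<notin> V} = {}" "{e \<in> E. h e \<in> V \<and> t e \<notin> V} = {}"
      using th by auto
    then show ?thesis
      by (simp only: sum_net[OF fin(2,1)] sum.empty diff_self)
  qed
  then have total: "(\<Sum>v\<in>V. b v - net E t h f v) = 0"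
    using b by (simp add: sum_subtractf)
  have "net E t h f x = b x" if "x \<in> V" for x
  proof (rule ccontr)
    assume ne: "net E t h f x \<noteq> b x"
    obtain v where v: "v \<in> V" "net E t h f v < b v"
    proof (rule ccontr)
      assume "\<not> thesis"
      then have le: "\<And>v. v \<in> V \<Longrightarrow> b v - net E t h f v \<le> 0"
        using that by force
      moreover have "(\<Sum>v\<in>V. net E t h f v - b v) = 0"
        using total by (simp add: sum_subtractf)
      ultimately have "\<forall>v\<in>V. net E t h f v - b v = 0"
        using fin(1) by (subst sum_nonneg_eq_0_iff[symmetric]) auto
      then have "net E t h f x - b x = 0"
        using \<open>x \<in> V\<close> by blast
      then show False using ne by simp
    qed
    obtain X where X: "X \<subseteq> V" "v \<in> X"
      and send: "\<And>x. x \<in> X \<Longrightarrow> \<exists>f'. feasible E l u f' \<and> (\<forall>y. net E t h f' y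
        = net E t h f y + (if y = v then 1 else 0) - (if y = x then 1 else 0))"
      and out: "\<And>e. e \<in> E \<Longrightarrow> t e \<in> X \<Longrightarrow> h e \<notin> X \<Longrightarrow> f e = u e"
      and into: "\<And>e. e \<in> E \<Longrightarrow> h e \<in> X \<Longrightarrow> t e \<notin> X \<Longrightarrow> f e = l e"
      using residual_closure[OF fin th f v(1)] by blast
    have "finite X"
      using X fin finite_subset by blast
    have pos: "0 \<le> b y - net E t h f y" if y: "y \<in> X" for y
    proof (rule ccontr)
      assume neg: "\<not> ?thesis"
      obtain f' where f': "feasible E l u f'" "\<And>z. net E t h f' z
          = net E t h f z + (if z = v then 1 else 0) - (if z = y then 1 else 0)"
        using send[OF y] by blast
      have "v \<noteq> y"
        using v neg by auto
      have "(\<Sum>v\<in>V. \<bar>b v - net E t h f' v\<bar>) < (\<Sum>v\<in>V. \<bar>b v - net E t h f v\<bar>)"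
      proof (rule sum_strict_mono_ex1)
        show "\<forall>z\<in>V. \<bar>b z - net E t h f' z\<bar> \<le> \<bar>b z - net E t h f z\<bar>"
          using v neg \<open>v \<noteq> y\<close> by (auto simp: f'(2))
        show "\<exists>z\<in>V. \<bar>b z - net E t h f' z\<bar> < \<bar>b z - net E t h f z\<bar>"
          using v neg \<open>v \<noteq> y\<close> by (auto simp: f'(2) intro!: bexI[of _ v])
      qed (fact fin)
      moreover have "0 \<le> (\<Sum>v\<in>V. \<bar>b v - net E t h f' v\<bar>)"
        by (rule sum_nonneg) simp
      ultimately have "D f' < D f"
        unfolding D_def by linarith
      then show False
        using min[OF f'(1)] by simp
    qed
    have "0 < (\<Sum>y\<in>X. b y - net E t h f y)"
      using sum_pos2[OF \<open>finite X\<close> X(2), of "\<lambda>y. b y - net E t h f y"] pos v by auto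
    moreover have "(\<Sum>y\<in>X. net E t h f y)
      = (\<Sum>e | e \<in> E \<and> t e \<in> X \<and> h e \<notin> X. u e) - (\<Sum>e | e \<in> E \<and> h e \<in> X \<and> t e \<notin> X. l e)"
      unfolding sum_net[OF fin(2) \<open>finite X\<close>] using out into
      by (intro arg_cong2[of _ _ _ _ "(-)"] sum.cong) auto
    ultimately show False
      using cut[OF X(1)] by (simp add: sum_subtractf)
  qed
  then show thesis
    using that f by blast
qed

section \<open>Hall's and Tutte's theorems\<close>

text \<open>Induction in the style of Halmos and Vaughan. If some proper nonempty \<open>J\<close>
  satisfies the condition with equality, represent \<open>J\<close> first and the other indices by
  elements outside the union over \<open>J\<close>. Otherwise every proper nonempty subfamily has an
  element to spare, so one representative can be fixed arbitrarily.\<close>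

theorem hall:
  assumes "finite I" "\<And>i. i \<in> I \<Longrightarrow> finite (N i)"
    and "\<And>J. J \<subseteq> I \<Longrightarrow> card J \<le> card (\<Union>i\<in>J. N i)"
  shows "\<exists>r. inj_on r I \<and> (\<forall>i\<in>I. r i \<in> N i)"
  using assms
proof (induction I arbitrary: N rule: finite_psubset_induct)
  case (psubset I)
  have fin: "finite (\<Union>i\<in>J. N i)" if "J \<subseteq> I" for J
    using that psubset.prems(1) by (intro finite_UN_I finite_subset[OF that psubset.hyps]) auto
  show ?case
  proof (cases "\<exists>J. J \<subset> I \<and> J \<noteq> {} \<and> card J = card (\<Union>i\<in>J. N i)")
    case True
    then obtain J where J: "J \<subset> I" "J \<noteq> {}" "card J = card (\<Union>i\<in>J. N i)" by blast
    let ?U = "\<Union>i\<in>J. N i"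
    have "\<exists>r. inj_on r J \<and> (\<forall>i\<in>J. r i \<in> N i)"
      by (rule psubset.IH) (use J psubset.prems in auto)
    then obtain r1 where r1: "inj_on r1 J" "\<And>i. i \<in> J \<Longrightarrow> r1 i \<in> N i" by blast
    have "\<exists>r. inj_on r (I - J) \<and> (\<forall>i\<in>I - J. r i \<in> N i - ?U)"
    proof (rule psubset.IH)
      show "I - J \<subset> I" using J by blast
      show "finite (N i - ?U)" if "i \<in> I - J" for i
        using that psubset.prems(1) by blast
      fix L assume L: "L \<subseteq> I - J"
      have "finite L" "finite J"
        using L J psubset.hyps finite_subset by blast+
      have "card L + card J = card (L \<union> J)"
        using L \<open>finite L\<close> \<open>finite J\<close> by (subst card_Un_disjoint) auto
      also have "\<dots> \<le> card (\<Union>i\<in>L \<union> J. N i)"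
        by (rule psubset.prems(2)) (use L J in blast)
      also have "(\<Union>i\<in>L \<union> J. N i) = (\<Union>i\<in>L. N i - ?U) \<union> ?U" by blast
      also have "card \<dots> \<le> card (\<Union>i\<in>L. N i - ?U) + card ?U"
        by (rule card_Un_le)
      finally show "card L \<le> card (\<Union>i\<in>L. N i - ?U)"
        using J(3) by simp
    qed
    then obtain r2 where r2: "inj_on r2 (I - J)" "\<And>i. i \<in> I - J \<Longrightarrow> r2 i \<in> N i - ?U" by blast
    define r where "r i = (if i \<in> J then r1 i else r2 i)" for i
    have "inj_on r (J \<union> (I - J))"
    proof (subst inj_on_Un, intro conjI)
      show "inj_on r J" "inj_on r (I - J)"
        using r1(1) r2(1) by (auto simp: r_def inj_on_def)
      have "r ` J \<subseteq> ?U" "r ` (I - J) \<inter> ?U = {}"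
        using r1(2) r2(2) by (auto simp: r_def)
      then show "r ` (J - (I - J)) \<inter> r ` (I - J - J) = {}"
        by blast
    qed
    moreover have "J \<union> (I - J) = I" using J by blast
    moreover have "\<forall>i\<in>I. r i \<in> N i"
      using r1(2) r2(2) by (auto simp: r_def)
    ultimately show ?thesis by auto
  next
    case False
    show ?thesis
    proof (cases "I = {}")
      case False
      then obtain i where i: "i \<in> I" by blast
      have "card {i} \<le> card (\<Union>j\<in>{i}. N j)"
        by (rule psubset.prems(2)) (use i in simp)
      then obtain x where x: "x \<in> N i" by fastforce
      have "\<exists>r. inj_on r (I - {i}) \<and> (\<forall>j\<in>I - {i}. r j \<in> N j - {x})"
      proof (rule psubset.IH)
        show "I - {i} \<subset> I" using i by blast
        show "finite (N j - {x})" if "j \<in> I - {i}" for j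
          using that psubset.prems(1) by blast
        fix L assume L: "L \<subseteq> I - {i}"
        show "card L \<le> card (\<Union>j\<in>L. N j - {x})"
        proof (cases "L = {}")
          case False
          have LI: "L \<subset> I" using L i by blast
          then have "card L \<noteq> card (\<Union>j\<in>L. N j)"
            using \<open>\<nexists>J. _\<close> False by blast
          then have "card L < card (\<Union>j\<in>L. N j)"
            using psubset.prems(2)[of L] LI by (simp add: le_neq_implies_less psubset_imp_subset)
          also have "\<dots> \<le> card ((\<Union>j\<in>L. N j) - {x}) + 1"
            using card_Suc_Diff1[of "\<Union>j\<in>L. N j" x] fin[of L] LI by (cases "x \<in> (\<Union>j\<in>L. N j)") auto
          also have "(\<Union>j\<in>L. N j) - {x} = (\<Union>j\<in>L. N j - {x})"
            by blast
          finally show ?thesis by simp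
        qed simp
      qed
      then obtain r where r: "inj_on r (I - {i})" "\<And>j. j \<in> I - {i} \<Longrightarrow> r j \<in> N j - {x}" by blast
      have "inj_on (r(i := x)) I"
        using r by (fastforce simp: inj_on_def)
      moreover have "\<forall>j\<in>I. (r(i := x)) j \<in> N j"
        using r x by auto
      ultimately show ?thesis by blast
    qed auto
  qed
qed

text \<open>
  The members of \<open>K\<close> need not be connected. Hence no components have to be counted, and
  \<^prop>\<open>card K \<le> card S\<close> for all such pairs is still equivalent to Tutte's condition.
\<close>

definition odd_separation :: "('v \<Rightarrow> 'v \<Rightarrow> bool) \<Rightarrow> 'v set \<Rightarrow> 'v set \<Rightarrow> 'v set set \<Rightarrow> bool" where
  "odd_separation adj V S K \<longleftrightarrow> S \<subseteq> V \<and> pairwise disjnt K \<and>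
    (\<forall>C\<in>K. C \<subseteq> V - S \<and> odd (card C) \<and> (\<forall>x\<in>C. \<forall>y\<in>V. adj x y \<longrightarrow> y \<in> C \<union> S))"

definition perfect_matching :: "('v \<Rightarrow> 'v \<Rightarrow> bool) \<Rightarrow> 'v set \<Rightarrow> ('v \<Rightarrow> 'v) \<Rightarrow> bool" where
  "perfect_matching adj V m \<longleftrightarrow> (\<forall>x\<in>V. m x \<in> V \<and> m x \<noteq> x \<and> m (m x) = x \<and> adj x (m x))"

lemma odd_separation_finite: "finite V \<Longrightarrow> odd_separation adj V S K \<Longrightarrow> finite K"
  by (rule finite_subset[of _ "Pow V"]) (auto simp: odd_separation_def)

lemma odd_separation_member_finite: "odd_separation adj V S K \<Longrightarrow> C \<in> K \<Longrightarrow> finite C"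
  unfolding odd_separation_def by (metis card.infinite even_zero)

text \<open>All members of \<open>K\<close> are odd, which gives the parity. By symmetry of
  \<open>adj\<close> the uncovered set \<open>R\<close> is joined only to \<open>S\<close>, so it
  can serve as a further member whenever its size is odd.\<close>

lemma odd_separation_rest:
  assumes fin: "finite V" and sym: "\<And>x y. adj x y \<Longrightarrow> adj y x" and sep: "odd_separation adj V S K"
  defines "R \<equiv> V - S - \<Union>K"
  shows "even (card V) \<longleftrightarrow> even (card S + card K + card R)"
    and "x \<in> R \<Longrightarrow> y \<in> V \<Longrightarrow> adj x y \<Longrightarrow> y \<in> R \<union> S"
proof -
  have K: "finite K" "\<And>C. C \<in> K \<Longrightarrow> finite C" "S \<subseteq> V" "\<Union>K \<subseteq> V - S"
    using odd_separation_finite[OF fin sep] odd_separation_member_finite[OF sep] sep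
    unfolding odd_separation_def by blast+
  have "card V = card S + card (\<Union>K) + card R"
  proof -
    have "V = S \<union> \<Union>K \<union> R" "S \<inter> \<Union>K = {}" "(S \<union> \<Union>K) \<inter> R = {}"
      using K by (auto simp: R_def)
    then show ?thesis
      using fin by (metis card_Un_disjoint finite_Un)
  qed
  moreover have "card (\<Union>K) = sum card K"
    by (rule card_Union_disjoint) (use sep K in \<open>auto simp: odd_separation_def\<close>)
  moreover have "{C \<in> K. odd (card C)} = K"
    using sep by (auto simp: odd_separation_def)
  then have "even (sum card K) \<longleftrightarrow> even (card K)"
    using even_sum_iff[OF K(1), of card] by simp
  ultimately show "even (card V) \<longleftrightarrow> even (card S + card K + card R)"
    by simp
  show "y \<in> R \<union> S" if xy: "x \<in> R" "y \<in> V" "adj x y"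
  proof (rule ccontr)
    assume "y \<notin> R \<union> S"
    then obtain C where C: "C \<in> K" "y \<in> C"
      using xy(2) by (auto simp: R_def)
    moreover have "x \<in> V" "adj y x"
      using xy sym by (auto simp: R_def)
    ultimately have "x \<in> C \<union> S"
      using sep unfolding odd_separation_def by blast
    then show False
      using xy(1) C by (auto simp: R_def)
  qed
qed

text \<open>Induction on \<open>V\<close>, with a largest \<open>S\<close> that attains equality.
  Maximality forces \<open>K\<close> to cover \<open>V - S\<close> and lets the induction hypothesis
  match every member of \<open>K\<close> minus any one vertex; Hall's theorem matches
  \<open>K\<close> with \<open>S\<close>.\<close>

theorem tutte:
  assumes "finite V" and sym: "\<And>x y. adj x y \<Longrightarrow> adj y x"
    and "\<And>S K. odd_separation adj V S K \<Longrightarrow> card K \<le> card S"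
  shows "\<exists>m. perfect_matching adj V m"
  using assms(1,3)
proof (induction V rule: finite_psubset_induct)
  case (psubset V)
  note fin = psubset.hyps
  have "even (card V)"
  proof (rule ccontr)
    assume "odd (card V)"
    then have "odd_separation adj V {} {V}"
      by (auto simp: odd_separation_def)
    then show False using psubset.prems by fastforce
  qed
  define P where "P S \<longleftrightarrow> (\<exists>K. odd_separation adj V S K \<and> card K = card S)" for S
  have "P {}"
    unfolding P_def by (intro exI[of _ "{}"]) (auto simp: odd_separation_def)
  moreover have "card S < Suc (card V)" if "P S" for S
    using that card_mono[OF fin] by (auto simp: P_def odd_separation_def less_Suc_eq_le)
  ultimately obtain S where "P S" and max: "\<And>S'. P S' \<Longrightarrow> card S' \<le> card S"
    using ex_has_greatest_nat[of P "{}" card "Suc (card V)"] by blast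
  then obtain K where sep: "odd_separation adj V S K" and card_K: "card K = card S"
    by (auto simp: P_def)
  have finK: "finite K" by (rule odd_separation_finite[OF fin sep])
  have S: "S \<subseteq> V" "finite S"
    using sep fin finite_subset by (auto simp: odd_separation_def)
  have K: "C \<subseteq> V - S" "odd (card C)" "finite C" "x \<in> C \<Longrightarrow> y \<in> V \<Longrightarrow> adj x y \<Longrightarrow> y \<in> C \<union> S"
    if "C \<in> K" for C x y
    using that sep odd_separation_member_finite[OF sep] unfolding odd_separation_def by blast+
  have disj: "C = D" if "C \<in> K" "D \<in> K" "x \<in> C" "x \<in> D" for C D x
    using that sep by (auto simp: odd_separation_def pairwise_def disjnt_def)
  \<comment> \<open>By parity the leftover set is even; moving one of its vertices to
    \<open>S\<close> makes the rest a new odd member, so a larger \<open>S\<close> attains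
    equality.\<close>
  have cover: "V - S - \<Union>K = {}"
  proof (rule ccontr)
    let ?R = "V - S - \<Union>K"
    assume "?R \<noteq> {}"
    then obtain x where x: "x \<in> ?R" by blast
    have "even (card ?R)"
      using odd_separation_rest(1)[OF fin sym sep] \<open>even (card V)\<close> card_K by simp
    then have odd: "odd (card (?R - {x}))"
      using x fin card_Suc_Diff1[of ?R x] by (metis even_Suc finite_Diff)
    then have new: "?R - {x} \<notin> K"
    proof -
      have "?R - {x} \<noteq> {}" using odd by (metis card.empty even_zero)
      then show ?thesis by blast
    qed
    have "odd_separation adj V (insert x S) (insert (?R - {x}) K)"
      unfolding odd_separation_def
    proof (intro conjI ballI impI)
      show "insert x S \<subseteq> V" using x S by blast
      show "pairwise disjnt (insert (?R - {x}) K)"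
        using sep unfolding odd_separation_def pairwise_insert by (auto simp: disjnt_def)
      fix C assume C: "C \<in> insert (?R - {x}) K"
      show "C \<subseteq> V - insert x S" "odd (card C)"
        using C K x odd by blast+
      show "z \<in> C \<union> insert x S" if "y \<in> C" "z \<in> V" "adj y z" for y z
        using C that odd_separation_rest(2)[OF fin sym sep, of y z] K(4)[of C y z] by blast
    qed
    moreover have "card (insert (?R - {x}) K) = card (insert x S)"
      using new finK S x card_K by simp
    ultimately have "card (insert x S) \<le> card S"
      by (intro max) (auto simp: P_def)
    then show False using x S by simp
  qed
  \<comment> \<open>A violation \<open>T\<close>, \<open>L\<close> inside \<open>C - {x}\<close> has
    surplus at least 2 by parity, once the leftover \<open>?Q\<close> is added to \<open>L\<close>
    if necessary. Replacing \<open>C\<close> by these pieces and adding \<open>T\<close> and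
    \<open>x\<close> to \<open>S\<close> again gives a larger set with equality.\<close>
  have "\<exists>m. perfect_matching adj (C - {x}) m" if C: "C \<in> K" "x \<in> C" for C x
  proof (rule psubset.IH)
    show "C - {x} \<subset> V"
      using K(1)[OF C(1)] C(2) by blast
    fix T L assume sepL: "odd_separation adj (C - {x}) T L"
    have finC: "finite (C - {x})" using K(3)[OF C(1)] by simp
    show "card L \<le> card T"
    proof (rule ccontr)
      assume less: "\<not> card L \<le> card T"
      have "even (card (C - {x}))"
        using K(2,3)[OF C(1)] C(2) by simp
      let ?Q = "C - {x} - T - \<Union>L"
      note rest = odd_separation_rest[OF finC sym sepL]
      have T: "T \<subseteq> C - {x}" "finite T"
        using sepL finC finite_subset by (auto simp: odd_separation_def)
      obtain L' where L': "odd_separation adj (C - {x}) T L'" "card T + 2 \<le> card L'"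
      proof (cases "card L = card T + 1")
        case True
        then have odd: "odd (card ?Q)"
          using rest(1) \<open>even (card (C - {x}))\<close> by simp
        then have "?Q \<noteq> {}" by (metis card.empty even_zero)
        then have "?Q \<notin> L" by blast
        then have "card (insert ?Q L) = card T + 2"
          using True odd_separation_finite[OF finC sepL] by simp
        moreover have "odd_separation adj (C - {x}) T (insert ?Q L)"
          unfolding odd_separation_def
        proof (intro conjI ballI impI)
          show "T \<subseteq> C - {x}" by (fact T)
          show "pairwise disjnt (insert ?Q L)"
            using sepL unfolding odd_separation_def pairwise_insert by (auto simp: disjnt_def)
          fix D assume D: "D \<in> insert ?Q L"
          show "D \<subseteq> C - {x} - T" "odd (card D)"
            using D odd sepL unfolding odd_separation_def by blast+
          show "z \<in> D \<union> T" if "y \<in> D" "z \<in> C - {x}" "adj y z" for y z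
            using D
          proof
            assume "D = ?Q"
            then show ?thesis using rest(2)[of y z] that by blast
          next
            assume "D \<in> L"
            then show ?thesis using sepL that unfolding odd_separation_def by blast
          qed
        qed
        ultimately show thesis using that by simp
      next
        case False
        then show thesis using that[OF sepL] less by simp
      qed
      let ?S = "S \<union> insert x T" and ?K = "(K - {C}) \<union> L'"
      have sub: "D \<subseteq> C - {x} - T" "odd (card D)" if "D \<in> L'" for D
        using that L'(1) unfolding odd_separation_def by blast+
      have sep': "odd_separation adj V ?S ?K"
        unfolding odd_separation_def
      proof (intro conjI ballI impI)
        show "?S \<subseteq> V" using S T K(1)[OF C(1)] C(2) by blast
        show "pairwise disjnt ?K"
        proof (rule pairwiseI)
          fix D E assume DE: "D \<in> ?K" "E \<in> ?K" "D \<noteq> E"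
          consider "D \<in> K - {C}" "E \<in> K - {C}" | "D \<in> L'" "E \<in> L'" | "D \<in> K - {C}" "E \<subseteq> C" | "D \<subseteq> C" "E \<in> K - {C}"
            using DE sub by blast
          then show "disjnt D E"
          proof cases
            case 1
            then show ?thesis using disj DE by (auto simp: disjnt_def)
          next
            case 2
            then show ?thesis using L'(1) DE unfolding odd_separation_def pairwise_def by blast
          next
            case 3
            then show ?thesis using disj C by (fastforce simp: disjnt_def)
          next
            case 4
            then show ?thesis using disj C by (fastforce simp: disjnt_def)
          qed
        qed
        fix D assume D: "D \<in> ?K"
        show "D \<subseteq> V - ?S"
        proof (cases "D \<in> L'")
          case True
          then show ?thesis using sub(1) K(1)[OF C(1)] by blast
        next
          case False
          then have "D \<in> K" "D \<noteq> C" using D by auto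
          then have "D \<inter> C = {}" using disj C by blast
          then show ?thesis using K(1)[OF \<open>D \<in> K\<close>] T C(2) by blast
        qed
        show "odd (card D)"
          using D sub K by blast
        show "z \<in> D \<union> ?S" if z: "y \<in> D" "z \<in> V" "adj y z" for y z
        proof (cases "D \<in> L'")
          case True
          then have "y \<in> C" using z sub by blast
          then have "z \<in> C \<union> S" using K(4)[OF C(1)] z by blast
          then show ?thesis
            using True L'(1) z unfolding odd_separation_def by blast
        next
          case False
          then show ?thesis using D K(4)[of D y z] z by blast
        qed
      qed
      have "finite L'"
        by (rule odd_separation_finite[OF finC L'(1)])
      have "(K - {C}) \<inter> L' = {}"
      proof -
        have "D \<noteq> {}" if "D \<in> L'" for D
          using sub(2)[OF that] by (metis card.empty even_zero)
        then show ?thesis using sub(1) disj C by blast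
      qed
      then have "card ?K = card K - 1 + card L'"
        using finK \<open>finite L'\<close> C(1) by (simp add: card_Un_disjoint card_Diff_singleton)
      moreover have "card K \<noteq> 0"
        using C(1) finK by auto
      moreover have card_S: "card ?S = card S + (card T + 1)"
      proof -
        have "S \<inter> insert x T = {}" "x \<notin> T"
          using K(1)[OF C(1)] C(2) T by auto
        then show ?thesis using S T by (simp add: card_Un_disjoint)
      qed
      ultimately have "card ?S \<le> card ?K"
        using L'(2) card_K by linarith
      then have "card ?K = card ?S"
        using psubset.prems[OF sep'] by simp
      then have "card ?S \<le> card S"
        using sep' by (intro max) (auto simp: P_def)
      then show False using card_S by simp
    qed
  qed
  then obtain M where M: "\<And>C x. C \<in> K \<Longrightarrow> x \<in> C \<Longrightarrow> perfect_matching adj (C - {x}) (M C x)"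
    by metis
  define N where "N C = {s \<in> S. \<exists>x\<in>C. adj x s}" for C
  \<comment> \<open>Hall's condition for \<open>J\<close> is the hypothesis for the separation that
    has the neighbours of \<open>J\<close> in place of \<open>S\<close>.\<close>
  have "\<exists>r. inj_on r K \<and> (\<forall>C\<in>K. r C \<in> N C)"
  proof (rule hall[OF finK])
    show "finite (N C)" if "C \<in> K" for C
      using S by (simp add: N_def)
    fix J assume J: "J \<subseteq> K"
    show "card J \<le> card (\<Union>C\<in>J. N C)"
    proof (rule psubset.prems)
      show "odd_separation adj V (\<Union>C\<in>J. N C) J"
        unfolding odd_separation_def
      proof (intro conjI ballI impI)
        show "(\<Union>C\<in>J. N C) \<subseteq> V" using S by (auto simp: N_def)
        show "pairwise disjnt J"
          using sep pairwise_subset[OF _ J] by (simp add: odd_separation_def)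
        fix C assume C: "C \<in> J"
        show "C \<subseteq> V - (\<Union>C\<in>J. N C)" "odd (card C)"
          using K[of C] J C by (auto simp: N_def)
        show "y \<in> C \<union> (\<Union>C\<in>J. N C)" if "x \<in> C" "y \<in> V" "adj x y" for x y
          using K(4)[of C x y] J C that by (auto simp: N_def)
      qed
    qed
  qed
  then obtain r where r: "inj_on r K" "\<And>C. C \<in> K \<Longrightarrow> r C \<in> N C" by blast
  have rS: "bij_betw r K S"
    unfolding bij_betw_def
  proof
    show "r ` K = S"
      by (rule card_subset_eq) (use r S card_K card_image[OF r(1)] in \<open>auto simp: N_def\<close>)
  qed (fact r)
  have "\<forall>C\<in>K. \<exists>x. x \<in> C \<and> adj x (r C)"
    using r(2) by (auto simp: N_def)
  then obtain c where c: "\<And>C. C \<in> K \<Longrightarrow> c C \<in> C \<and> adj (c C) (r C)"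
    by metis
  have "\<forall>x\<in>V - S. \<exists>C. C \<in> K \<and> x \<in> C"
    using cover by blast
  then obtain k where k: "\<And>x. x \<in> V - S \<Longrightarrow> k x \<in> K \<and> x \<in> k x"
    by metis
  have k_eq: "k x = C" if "C \<in> K" "x \<in> C" for x C
    using that disj k K(1) by blast
  \<comment> \<open>\<open>c C\<close> is the vertex of \<open>C\<close> matched to the
    representative \<open>r C\<close> in \<open>S\<close>; \<open>k x\<close> is the member
    containing \<open>x\<close>, whose other vertices are matched by induction.\<close>
  define m where "m x = (if x \<in> S then c (inv_into K r x)
    else if x = c (k x) then r (k x) else M (k x) (c (k x)) x)" for x
  have m_c: "m (c C) = r C" "m (r C) = c C" if "C \<in> K" for C
  proof -
    have "c C \<notin> S" "k (c C) = C" "r C \<in> S"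
      using c K(1) k_eq r(2) that by (auto simp: N_def)
    then show "m (c C) = r C" "m (r C) = c C"
      using that r(1) by (auto simp: m_def)
  qed
  have "m x \<in> V \<and> m x \<noteq> x \<and> m (m x) = x \<and> adj x (m x)" if x: "x \<in> V" for x
  proof -
    consider C where "C \<in> K" "x = r C" | C where "C \<in> K" "x = c C"
      | C where "C \<in> K" "x \<in> C - {c C}"
      using x rS k unfolding bij_betw_def by (metis DiffI imageE singletonD)
    then show ?thesis
    proof cases
      case 1
      then show ?thesis
        using m_c[of C] c[of C] K(1)[of C] r(2)[of C] sym unfolding N_def by (auto simp: subset_iff)
    next
      case 2
      then show ?thesis
        using m_c[of C] c[of C] K(1)[of C] r(2)[of C] S unfolding N_def by (auto simp: subset_iff)
    next
      case 3
      have m_M: "m y = M C (c C) y" if "y \<in> C - {c C}" for y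
        using that 3(1) K(1)[of C] k_eq[of C y] by (auto simp: m_def)
      have "perfect_matching adj (C - {c C}) (M C (c C))"
        using M c 3 by blast
      then show ?thesis
        using 3 m_M K(1)[of C] unfolding perfect_matching_def by (metis DiffD1 subsetD)
    qed
  qed
  then show ?case
    unfolding perfect_matching_def by blast
qed

section \<open>Balanced signings\<close>

lemma even_card_involution:
  assumes "finite S" "\<And>x. x \<in> S \<Longrightarrow> g x \<in> S \<and> g x \<noteq> x \<and> g (g x) = x"
  shows "even (card S)"
  using assms
proof (induction S rule: finite_psubset_induct)
  case (psubset S)
  show ?case
  proof (cases "S = {}")
    case False
    then obtain x where x: "x \<in> S" by blast
    let ?T = "S - {x, g x}"
    have "even (card ?T)"
    proof (rule psubset.IH)
      show "?T \<subset> S" using x by blast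
      show "g y \<in> ?T \<and> g y \<noteq> y \<and> g (g y) = y" if "y \<in> ?T" for y
        using that psubset.prems x by (metis DiffD1 DiffD2 DiffI insertCI insertE singletonD)
    qed
    moreover have "card S = card ?T + 2"
      using psubset.prems[OF x] x psubset.hyps card_Diff_subset[of "{x, g x}" S]
        card_mono[of S "{x, g x}"] by auto
    ultimately show ?thesis by simp
  qed simp
qed

lemma sum_antisymmetric_involution:
  fixes w :: "'v \<Rightarrow> int"
  assumes "\<And>x. x \<in> S \<Longrightarrow> g x \<in> S \<and> g (g x) = x" "\<And>x. x \<in> S \<Longrightarrow> w (g x) = - w x"
  shows "sum w S = 0"
proof -
  have "sum w S = (\<Sum>x\<in>S. w (g x))"
    by (rule sum.reindex_bij_witness[of _ g g]) (use assms in auto)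
  then have "sum w S = - sum w S"
    by (simp add: assms(2) sum_negf)
  then show ?thesis by simp
qed

text \<open>The orbit of \<open>v\<close> under \<open>n \<circ> m\<close> is disjoint from its image under \<open>m\<close>; it gets the sign \<open>1\<close>.\<close>

lemma two_involutions_signing:
  assumes "finite V"
    and "\<And>x. x \<in> V \<Longrightarrow> m x \<in> V \<and> m x \<noteq> x \<and> m (m x) = x"
    and "\<And>x. x \<in> V \<Longrightarrow> n x \<in> V \<and> n x \<noteq> x \<and> n (n x) = x"
  shows "\<exists>w :: 'v \<Rightarrow> int. \<forall>x\<in>V. w x \<in> {1, -1} \<and> w (m x) = - w x \<and> w (n x) = - w x"
  using assms
proof (induction V rule: finite_psubset_induct)
  case (psubset V)
  note m = psubset.prems(1) and n = psubset.prems(2)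
  show ?case
  proof (cases "V = {}")
    case False
    then obtain v where v: "v \<in> V" by blast
    define r where "r x = n (m x)" for x
    have r_in: "r x \<in> V" if "x \<in> V" for x
      using that m n by (auto simp: r_def)
    have pow_in: "(r ^^ k) x \<in> V" if "x \<in> V" for k x
      using that by (induction k) (auto intro: r_in)
    \<comment> \<open>If \<open>r\<close> led from \<open>x\<close> to \<open>m x\<close> in
      \<open>k\<close> steps, cancelling a step at both ends would lead from \<open>r x\<close> to
      \<open>m (r x)\<close> in \<open>k - 2\<close> steps. The descent ends at a fixed point of
      \<open>m\<close> or of \<open>n\<close>.\<close>
    have no_return: "(r ^^ k) x \<noteq> m x" if "x \<in> V" for k x
      using that
    proof (induction k arbitrary: x rule: less_induct)
      case (less k)
      consider "k = 0" | "k = 1" | j where "k = Suc (Suc j)"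
        by (metis One_nat_def not0_implies_Suc)
      then show ?case
      proof cases
        case 1
        then show ?thesis using m[OF less.prems] by auto
      next
        case 2
        then show ?thesis using m[OF less.prems] n[of "m x"] by (auto simp: r_def)
      next
        case (3 j)
        show ?thesis
        proof
          assume "(r ^^ k) x = m x"
          then have "r ((r ^^ j) (r x)) = m x"
            using 3 by (simp add: funpow_swap1)
          then have eq: "n (m ((r ^^ j) (r x))) = m x"
            using r_def[of "(r ^^ j) (r x)"] by simp
          have y: "(r ^^ j) (r x) \<in> V"
            using less.prems pow_in r_in by blast
          have "m ((r ^^ j) (r x)) = n (m x)"
            using arg_cong[OF eq, of n] n m[OF y] by simp
          then have "(r ^^ j) (r x) = m (r x)"
            using m[OF y] by (metis r_def)
          then show False
            using less.IH[of j "r x"] 3 less.prems r_in by auto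
        qed
      qed
    qed
    define O1 where "O1 = range (\<lambda>k. (r ^^ k) v)"
    have O1: "O1 \<subseteq> V" "v \<in> O1"
      using pow_in v by (auto simp: O1_def intro: range_eqI[of _ _ 0])
    have r_O1: "r x \<in> O1" if x: "x \<in> O1" for x
    proof -
      obtain k where "x = (r ^^ k) v" using x by (auto simp: O1_def)
      then have "r x = (r ^^ Suc k) v" by simp
      then show ?thesis unfolding O1_def by blast
    qed
    have "inj_on r V"
    proof (rule inj_on_inverseI)
      fix x assume "x \<in> V"
      then show "m (n (r x)) = x" using m n by (simp add: r_def)
    qed
    \<comment> \<open>By finiteness the injective \<open>r\<close> permutes its forward orbit, so
      every point has a predecessor in it.\<close>
    then have "r ` O1 = O1"
      using endo_inj_surj[of O1 r] r_O1 O1(1) psubset.hyps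
      by (meson finite_subset image_subsetI inj_on_subset)
    have m_O1: "m x \<notin> O1" if x: "x \<in> O1" for x
    proof
      assume "m x \<in> O1"
      then obtain i j where ij: "x = (r ^^ i) v" "m x = (r ^^ j) v"
        using x by (auto simp: O1_def)
      show False
      proof (cases "i \<le> j")
        case True
        then have "(r ^^ (j - i)) x = m x"
          using ij by (simp add: funpow_add[symmetric, THEN fun_cong, unfolded comp_apply])
        then show False using no_return x O1 by blast
      next
        case False
        then have "(r ^^ (i - j)) (m x) = m (m x)"
        proof -
          have "(r ^^ (i - j)) (m x) = x"
            using False ij by (simp add: funpow_add[symmetric, THEN fun_cong, unfolded comp_apply])
          then show ?thesis
            using m[of x] x O1(1) by auto
        qed
        then show False using no_return m x O1 by blast
      qed
    qed
    have n_O1: "n x \<in> m ` O1" if x: "x \<in> O1" for x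
    proof -
      obtain y where y: "y \<in> O1" "x = r y"
        using x \<open>r ` O1 = O1\<close> by blast
      then have "y \<in> V" using O1 by blast
      then have "n x = m y"
        using m n y by (simp add: r_def)
      then show ?thesis
        using y by blast
    qed
    have n_mO1: "n x \<in> O1" if "x \<in> m ` O1" for x
      using that r_O1 by (auto simp only: r_def[symmetric])
    have m_mO1: "m x \<in> O1" if "x \<in> m ` O1" for x
      using that m O1(1) by (auto dest!: subsetD)
    let ?U = "O1 \<union> m ` O1"
    have V_U: "m x \<notin> ?U \<and> n x \<notin> ?U" if x: "x \<in> V - ?U" for x
    proof -
      have "m (m x) \<notin> ?U" "n (n x) \<notin> ?U"
        using x m n by auto
      then show ?thesis
        using m_mO1[of "m x"] n_mO1[of "n x"] n_O1[of "n x"] by blast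
    qed
    have "\<exists>w :: 'v \<Rightarrow> int. \<forall>x\<in>V - ?U. w x \<in> {1, -1} \<and> w (m x) = - w x \<and> w (n x) = - w x"
    proof (rule psubset.IH)
      show "V - ?U \<subset> V"
        using v O1 by blast
      fix x assume x: "x \<in> V - ?U"
      show "m x \<in> V - ?U \<and> m x \<noteq> x \<and> m (m x) = x"
        using x m[of x] V_U[OF x] by blast
      show "n x \<in> V - ?U \<and> n x \<noteq> x \<and> n (n x) = x"
        using x n[of x] V_U[OF x] by blast
    qed
    then obtain w :: "'v \<Rightarrow> int" where w:
      "\<And>x. x \<in> V - ?U \<Longrightarrow> w x \<in> {1, -1} \<and> w (m x) = - w x \<and> w (n x) = - w x"
      by blast
    define w' where "w' x = (if x \<in> O1 then 1 else if x \<in> m ` O1 then - 1 else w x)" for x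
    have "w' x \<in> {1, -1} \<and> w' (m x) = - w' x \<and> w' (n x) = - w' x" if x: "x \<in> V" for x
    proof -
      consider "x \<in> O1" | "x \<in> m ` O1" | "x \<in> V - ?U"
        using x by blast
      then show ?thesis
      proof cases
        case 1
        moreover have "m x \<notin> O1" "m x \<in> m ` O1" "n x \<notin> O1" "n x \<in> m ` O1"
          using 1 m_O1 n_O1[OF 1] by auto
        ultimately show ?thesis by (simp add: w'_def)
      next
        case 2
        moreover have "x \<notin> O1" "m x \<in> O1" "n x \<in> O1"
          using 2 m_O1 n_mO1[OF 2] m_mO1[OF 2] by auto
        ultimately show ?thesis by (simp add: w'_def)
      next
        case 3
        then show ?thesis using V_U[OF 3] w[OF 3] by (auto simp: w'_def)
      qed
    qed
    then show ?thesis by blast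
  qed auto
qed

section \<open>Cuts of permutations, and 2-factors given by a successor function\<close>

definition cut :: "('v \<Rightarrow> 'v) \<Rightarrow> 'v set \<Rightarrow> nat" where
  "cut g X = card {x \<in> X. g x \<notin> X}"

lemma card_eq_inside_plus_cut:
  "finite X \<Longrightarrow> card X = card {x \<in> X. g x \<in> X} + cut g X"
  unfolding cut_def by (subst card_Un_disjoint[symmetric]) (auto intro: arg_cong[of _ _ card])

text \<open>\<open>g\<close> maps the points that stay in \<open>X\<close> onto the points that come
  from \<open>X\<close>, so as many leave as enter.\<close>

lemma cut_inverse:
  assumes "finite X" "\<And>x. x \<in> X \<Longrightarrow> g' (g x) = x" "\<And>x. x \<in> X \<Longrightarrow> g (g' x) = x"
  shows "cut g' X = cut g X"
proof -
  have "bij_betw g {x \<in> X. g x \<in> X} {x \<in> X. g' x \<in> X}"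
    by (rule bij_betw_byWitness[of _ g']) (use assms in auto)
  then show ?thesis
    using card_eq_inside_plus_cut[OF assms(1), of g] card_eq_inside_plus_cut[OF assms(1), of g']
    by (simp add: bij_betw_same_card)
qed

lemma cut_complement:
  assumes "\<And>x. x \<in> V \<Longrightarrow> g x \<in> V \<and> g' x \<in> V \<and> g' (g x) = x \<and> g (g' x) = x" "X \<subseteq> V"
  shows "cut g (V - X) = cut g' X"
proof -
  have "bij_betw g {x \<in> V - X. g x \<notin> V - X} {x \<in> X. g' x \<notin> X}"
    by (rule bij_betw_byWitness[of _ g']) (use assms in \<open>auto simp: subset_iff\<close>)
  then show ?thesis
    unfolding cut_def by (rule bij_betw_same_card)
qed

lemma cut_submodular:
  assumes "finite V" "X \<subseteq> V" "Y \<subseteq> V"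
  shows "cut g (X \<inter> Y) + cut g (X \<union> Y) \<le> cut g X + cut g Y"
proof -
  have *: "cut g Z = (\<Sum>x\<in>V. of_bool (x \<in> Z \<and> g x \<notin> Z))" if "Z \<subseteq> V" for Z
    using assms(1) that by (simp add: cut_def sum.If_cases of_bool_def)
      (auto intro: arg_cong[of _ _ card])
  have "X \<inter> Y \<subseteq> V" "X \<union> Y \<subseteq> V"
    using assms by auto
  then show ?thesis
    using assms by (simp add: * sum.distrib[symmetric] del: sum_of_bool_eq) (auto intro!: sum_mono)
qed

text \<open>
  A cubic graph with a 2-factor: \<open>m\<close> is the complementary perfect matching and \<open>s\<close> the successor
  along the circuits, each with a fixed sense of rotation, so that \<open>d X\<close> is the size of the edge
  boundary. The edges from \<open>x\<close> to \<open>s x\<close> with \<open>x \<in> A\<close> form a matching \<open>N\<^sub>2\<close>, which misses \<open>Y\<close>; so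
  \<open>cut n X\<close> and \<open>dN3 X\<close> are the numbers of its boundary edges and of those of the remaining circuit edges.
\<close>

locale circuit_matching =
  fixes V :: "'v set" and m s p :: "'v \<Rightarrow> 'v" and A :: "'v set"
  assumes finite_V: "finite V"
    and m: "x \<in> V \<Longrightarrow> m x \<in> V \<and> m x \<noteq> x \<and> m (m x) = x"
    and sp: "x \<in> V \<Longrightarrow> s x \<in> V \<and> p x \<in> V \<and> p (s x) = x \<and> s (p x) = x"
    and A: "A \<subseteq> V" "A \<inter> s ` A = {}"
begin

definition d :: "'v set \<Rightarrow> nat" where
  "d X = cut m X + cut s X + cut p X"

definition Y :: "'v set" where
  "Y = V - A - s ` A"

text \<open>The matching \<open>N\<^sub>2\<close> as an involution; its fixed points in
  \<open>V\<close> are exactly the elements of \<open>Y\<close>.\<close>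

definition n :: "'v \<Rightarrow> 'v" where
  "n x = (if x \<in> A then s x else if x \<in> s ` A then p x else x)"

definition dN3 :: "'v set \<Rightarrow> nat" where
  "dN3 X = card {x \<in> X - A. s x \<notin> X} + card {x \<in> X - s ` A. p x \<notin> X}"

lemma p_in_A_iff:
  assumes "x \<in> V"
  shows "p x \<in> A \<longleftrightarrow> x \<in> s ` A"
proof
  assume "p x \<in> A"
  then have "s (p x) \<in> s ` A" by (rule imageI)
  then show "x \<in> s ` A" using sp[OF assms] by simp
next
  assume "x \<in> s ` A"
  then obtain a where "a \<in> A" "x = s a" by blast
  then show "p x \<in> A" using sp A(1) by auto
qed

lemma s_in_sA_iff: "x \<in> V \<Longrightarrow> s x \<in> s ` A \<longleftrightarrow> x \<in> A"
  using p_in_A_iff[of "s x"] sp[of x] by simp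

lemma n_A: "x \<in> A \<Longrightarrow> n x = s x"
  by (simp add: n_def)

lemma n_sA: "x \<in> s ` A \<Longrightarrow> n x = p x"
  using A by (auto simp: n_def)

lemma n_Y: "x \<in> Y \<Longrightarrow> n x = x"
  unfolding n_def Y_def by auto

lemma V_cases [consumes 1, case_names A sA Y]:
  assumes "x \<in> V"
  obtains "x \<in> A" "s x \<in> s ` A" "s x \<notin> A" | "x \<in> s ` A" "p x \<in> A" "x \<notin> A" | "x \<in> Y" "x \<notin> A" "x \<notin> s ` A"
proof -
  consider "x \<in> A" | "x \<in> s ` A" | "x \<in> Y"
    using assms by (auto simp: Y_def)
  then show thesis
  proof cases
    case 1
    then show ?thesis using that(1) A(2) by blast
  next
    case 2
    then show ?thesis using that(2) A(2) p_in_A_iff[OF assms] by blast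
  next
    case 3
    then show ?thesis using that(3) by (simp add: Y_def)
  qed
qed

lemma n: assumes "x \<in> V" shows "n x \<in> V \<and> n (n x) = x"
  using assms by (cases rule: V_cases) (simp_all add: n_A n_sA n_Y sp assms)

lemma n_Y_iff: assumes "x \<in> V" shows "n x \<in> Y \<longleftrightarrow> x \<in> Y"
  using assms by (cases rule: V_cases) (auto simp: n_A n_sA n_Y Y_def)

lemma n_neq: assumes "x \<in> V - Y" shows "n x \<noteq> x"
proof -
  have "x \<in> V" using assms by blast
  then show ?thesis
    by (cases rule: V_cases) (use assms in \<open>auto simp: n_A n_sA\<close>)
qed

lemma finite_sub: "X \<subseteq> V \<Longrightarrow> finite X"
  using finite_V finite_subset by blast

lemma cut_p: "X \<subseteq> V \<Longrightarrow> cut p X = cut s X"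
  by (rule cut_inverse) (use sp finite_sub in auto)

lemma d_decompose:
  assumes "X \<subseteq> V"
  shows "d X = cut m X + cut n X + dN3 X"
proof -
  have fin: "finite X" by (rule finite_sub[OF assms])
  have "{x \<in> X. n x \<notin> X} = {x \<in> X \<inter> A. s x \<notin> X} \<union> {x \<in> X \<inter> s ` A. p x \<notin> X}"
    using A by (auto simp: n_def split: if_splits)
  then have "cut n X = card {x \<in> X \<inter> A. s x \<notin> X} + card {x \<in> X \<inter> s ` A. p x \<notin> X}"
    unfolding cut_def using fin A by (subst card_Un_disjoint[symmetric]) auto
  moreover have "cut s X = card {x \<in> X \<inter> A. s x \<notin> X} + card {x \<in> X - A. s x \<notin> X}"
    unfolding cut_def using fin
    by (subst card_Un_disjoint[symmetric]) (auto intro: arg_cong[of _ _ card])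
  moreover have "cut p X = card {x \<in> X \<inter> s ` A. p x \<notin> X} + card {x \<in> X - s ` A. p x \<notin> X}"
    unfolding cut_def using fin
    by (subst card_Un_disjoint[symmetric]) (auto intro: arg_cong[of _ _ card])
  ultimately show ?thesis
    by (simp add: d_def dN3_def)
qed

text \<open>Vertices matched inside \<open>X\<close> come in pairs, so \<open>cut m X\<close> has
  the parity of \<open>card X\<close>; the circuits leave and enter \<open>X\<close> equally
  often.\<close>

lemma even_d_iff:
  assumes "X \<subseteq> V"
  shows "even (d X) \<longleftrightarrow> even (card X)"
proof -
  have "even (card {x \<in> X. m x \<in> X})"
    by (rule even_card_involution[of _ m]) (use assms m finite_sub in auto)
  then have "even (card X) \<longleftrightarrow> even (cut m X)"
    using card_eq_inside_plus_cut[OF finite_sub[OF assms], of m] by auto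
  moreover have "d X = cut m X + 2 * cut s X"
    using cut_p[OF assms] by (simp add: d_def)
  ultimately show ?thesis by simp
qed

lemma d_complement: "X \<subseteq> V \<Longrightarrow> d (V - X) = d X"
  using cut_complement[of V m m X] cut_complement[of V s p X] cut_complement[of V p s X] m sp
  by (simp add: d_def)

lemma d_submodular: "X \<subseteq> V \<Longrightarrow> X' \<subseteq> V \<Longrightarrow> d (X \<inter> X') + d (X \<union> X') \<le> d X + d X'"
  using cut_submodular[OF finite_V, of X X' m] cut_submodular[OF finite_V, of X X' s]
    cut_submodular[OF finite_V, of X X' p]
  by (simp add: d_def)

text \<open>No edge of \<open>N\<^sub>3\<close> leaves \<open>X\<close>. Avoiding cardinalities
  makes passing to intersections and complements easy.\<close>

definition closed :: "'v set \<Rightarrow> bool" where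
  "closed X \<longleftrightarrow> (\<forall>x \<in> X - A. s x \<in> X) \<and> (\<forall>x \<in> X - s ` A. p x \<in> X)"

lemma closed_if_dN3:
  assumes "X \<subseteq> V" "dN3 X = 0"
  shows "closed X"
proof -
  have "finite X"
    by (rule finite_sub[OF assms(1)])
  then show ?thesis
    using assms(2) by (auto simp: closed_def dN3_def)
qed

lemma closed_Int: "closed X \<Longrightarrow> closed Z \<Longrightarrow> closed (X \<inter> Z)"
  by (auto simp: closed_def)

lemma closed_complement:
  assumes "X \<subseteq> V" "closed X"
  shows "closed (V - X)"
  unfolding closed_def
proof (intro conjI ballI)
  fix x assume x: "x \<in> V - X - A"
  then show "s x \<in> V - X"
    using assms sp[of x] s_in_sA_iff[of x] by (auto simp: closed_def) (metis DiffI)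
next
  fix x assume x: "x \<in> V - X - s ` A"
  then show "p x \<in> V - X"
    using assms sp[of x] p_in_A_iff[of x] by (auto simp: closed_def) (metis DiffI)
qed

text \<open>The edges of \<open>N\<^sub>3\<close> give a bijection between the vertices of
  \<open>X\<close> that are not tails and those that are not heads of \<open>N\<^sub>2\<close>.
  Hence \<open>X\<close> has equally many tails and heads, and its other vertices are those in
  \<open>Y\<close>.\<close>

lemma closed_parity:
  assumes "X \<subseteq> V" "closed X"
  shows "even (card X) \<longleftrightarrow> even (card (X \<inter> Y))"
proof -
  have fin: "finite X"
    by (rule finite_sub[OF assms(1)])
  have "bij_betw s (X - A) (X - s ` A)"
  proof (rule bij_betw_byWitness[of _ p])
    show "\<forall>x\<in>X - A. p (s x) = x" "\<forall>x\<in>X - s ` A. s (p x) = x"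
      using assms(1) sp by auto
    show "s ` (X - A) \<subseteq> X - s ` A"
      using assms s_in_sA_iff by (fastforce simp: closed_def)
    show "p ` (X - s ` A) \<subseteq> X - A"
      using assms p_in_A_iff by (fastforce simp: closed_def)
  qed
  then have "card (X - A) = card (X - s ` A)"
    by (rule bij_betw_same_card)
  moreover have "card X = card (X \<inter> A) + card (X - A)" "card X = card (X \<inter> s ` A) + card (X - s ` A)"
    using card_Int_Diff[OF fin] by auto
  moreover have "card (X - A) = card (X \<inter> s ` A) + card (X \<inter> Y)"
  proof -
    have "X - A = X \<inter> s ` A \<union> X \<inter> Y"
      using assms(1) A(2) by (auto simp: Y_def)
    moreover have "X \<inter> s ` A \<inter> (X \<inter> Y) = {}"
      by (auto simp: Y_def)
    ultimately show ?thesis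
      using fin by (simp add: card_Un_disjoint)
  qed
  ultimately have "card X = 2 * card (X \<inter> s ` A) + card (X \<inter> Y)"
    by linarith
  then show ?thesis by simp
qed

end

section \<open>Weight bounds, cyclic connectivity and critical sets\<close>

lemma sum_le_cut:
  fixes w :: "'v \<Rightarrow> int"
  assumes "finite X" "\<And>x. x \<in> X \<Longrightarrow> g x \<in> X \<Longrightarrow> g (g x) = x \<and> w (g x) = - w x" "\<And>x. x \<in> X \<Longrightarrow> w x \<le> 1"
  shows "sum w X \<le> int (cut g X)"
proof -
  have "sum w X = sum w {x \<in> X. g x \<in> X} + sum w {x \<in> X. g x \<notin> X}"
    using assms(1) by (subst sum.union_disjoint[symmetric]) (auto intro: arg_cong[of _ _ "sum w"])
  moreover have "sum w {x \<in> X. g x \<in> X} = 0"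
    by (rule sum_antisymmetric_involution[of _ g]) (use assms(2) in auto)
  moreover have "sum w {x \<in> X. g x \<notin> X} \<le> int (cut g X)"
    using sum_bounded_above[of "{x \<in> X. g x \<notin> X}" w 1] assms(3) by (simp add: cut_def)
  ultimately show ?thesis by simp
qed

text \<open>Here \<open>k\<close> stands for the weight of a set, \<open>i\<close> for its weight on
  \<open>Y\<close>, and \<open>a\<close>, \<open>b\<close>, \<open>c\<close> for its boundary edges
  in the three matchings. The bounds on \<open>a\<close> and \<open>b\<close> add up to
  \<open>2 * k - 2 \<le> d\<close>, so \<open>k\<close> is at most 5. Size excludes 1, parity
  excludes 2, 3 and 5, and \<open>k = 4\<close> leaves the stated values.\<close>

lemma tight_parameters:
  fixes k i :: int and a b c d :: nat
  assumes "even k \<longleftrightarrow> even d" "k \<le> int a" "k \<le> i + int b" "i \<le> 2" "3 * int d < 5 * k"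
    "d = a + b + c" "3 \<le> d"
  shows "d = 6 \<and> b = 2 \<and> c = 0 \<and> i = 2"
proof -
  have k: "k < 6" "0 < k" and d: "2 * k - 2 \<le> int d"
    using assms by linarith+
  from k consider "k = 1" | "k = 2" | "k = 3" | "k = 4" | "k = 5"
    by linarith
  then show ?thesis
  proof cases
    case 2
    then have "d = 3" using assms by linarith
    then show ?thesis using assms(1) 2 by simp
  next
    case 3
    then have "d = 4" using assms(5) d by linarith
    then show ?thesis using assms(1) 3 by simp
  next
    case 5
    then have "d = 8" using assms(5) d by linarith
    then show ?thesis using assms(1) 5 by simp
  qed (use assms in linarith)+
qed

text \<open>\<open>connectivity\<close> expresses cyclic 6-edge-connectivity by sizes: a nonempty
  side without a circuit induces a forest, and in a cubic graph it then has at least two more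
  boundary edges than vertices. By \<open>Y_orbit\<close> a circuit has at most one missed
  vertex.\<close>

locale cyclically_connected_circuit_matching = circuit_matching V m s p A
  for V :: "'v set" and m s p A +
  assumes connectivity: "X \<subseteq> V \<Longrightarrow> X \<noteq> {} \<Longrightarrow> X \<noteq> V \<Longrightarrow>
      6 \<le> d X \<or> card X + 2 \<le> d X \<or> card (V - X) + 2 \<le> d X"
    and Y_orbit: "y \<in> Y \<Longrightarrow> y' \<in> Y \<Longrightarrow> (s ^^ k) y = y' \<Longrightarrow> y = y'"
begin

definition signing :: "('v \<Rightarrow> int) \<Rightarrow> bool" where
  "signing w \<longleftrightarrow> (\<forall>x\<in>V. w x \<in> {1, -1} \<and> w (m x) = - w x) \<and> (\<forall>x\<in>V - Y. w (n x) = - w x)"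

text \<open>The one shape an unbalanced set can have; \<open>cut m X = 4\<close> follows by
  \<open>d_decompose\<close>. No signing is mentioned, so that complements and sets obtained from
  different signings can be combined.\<close>

definition critical :: "'v set \<Rightarrow> bool" where
  "critical X \<longleftrightarrow> X \<subseteq> V \<and> d X = 6 \<and> cut n X = 2 \<and> dN3 X = 0"

lemma d_ge_3:
  assumes "X \<subseteq> V" "X \<noteq> {}" "X \<noteq> V"
  shows "3 \<le> d X"
proof -
  have "1 \<le> card X" "1 \<le> card (V - X)"
    using assms finite_V finite_sub[OF assms(1)] by (auto simp: Suc_le_eq card_gt_0_iff)
  then show ?thesis
    using connectivity[OF assms] by linarith
qed

text \<open>
  The lower bounds \<open>\<Sum>\<^sub>X w\<close> and \<open>\<Sum>\<^sub>X w - 2\<close> for the numbers of boundary edges in the two matchings,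
  together with parity, leave a single exception to the balance condition.
\<close>

lemma unbalanced_imp_critical:
  assumes w: "signing w" and X: "X \<subseteq> V" and le: "sum w (X \<inter> Y) \<le> 2"
    and unbalanced: "3 * int (d X) < 5 * sum w X"
  shows "critical X \<and> sum w (X \<inter> Y) = 2"
proof -
  have fin: "finite X" by (rule finite_sub[OF X])
  have w1: "w x \<le> 1" if "x \<in> V" for x
    using w that by (auto simp: signing_def)
  have a: "sum w X \<le> int (cut m X)"
    by (rule sum_le_cut) (use w w1 X m fin in \<open>auto simp: signing_def\<close>)
  have "sum w (X - Y) \<le> int (cut n (X - Y))"
    by (rule sum_le_cut) (use w w1 X n fin in \<open>auto simp: signing_def dest!: subsetD\<close>)
  also have "{x \<in> X - Y. n x \<notin> X - Y} = {x \<in> X. n x \<notin> X}"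
    using X n_Y_iff n_Y by auto
  then have "cut n (X - Y) = cut n X"
    by (simp add: cut_def)
  finally have b: "sum w X \<le> sum w (X \<inter> Y) + int (cut n X)"
    using sum.Int_Diff[OF fin, of w Y] by simp
  \<comment> \<open>Signs are odd, so the weight of \<open>X\<close> has the parity of
    \<open>card X\<close>.\<close>
  have "2 dvd (\<Sum>x\<in>X. w x + 1)"
  proof (rule dvd_sum)
    fix x assume "x \<in> X"
    then have "w x = 1 \<or> w x = - 1" using w X by (auto simp: signing_def)
    then show "2 dvd w x + 1" by auto
  qed
  then have par: "even (sum w X) \<longleftrightarrow> even (d X)"
    using even_d_iff[OF X] by (simp add: sum.distrib)
  have "sum w X > 0"
    using unbalanced by linarith
  then have "X \<noteq> {}" "cut m X \<noteq> 0"
    using a by auto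
  moreover have "{x \<in> V. m x \<notin> V} = {}"
    using m by auto
  then have "cut m V = 0"
    unfolding cut_def by (simp only: card.empty)
  ultimately have "X \<noteq> {}" "X \<noteq> V"
    by auto
  then have "3 \<le> d X"
    by (rule d_ge_3[OF X])
  from tight_parameters[OF par a b le unbalanced d_decompose[OF X] this]
  show ?thesis
    using X by (simp add: critical_def)
qed

lemma critical_complement:
  assumes "critical X"
  shows "critical (V - X)"
proof -
  have X: "X \<subseteq> V" "dN3 X = 0"
    using assms by (auto simp: critical_def)
  have "closed (V - X)"
    using closed_complement closed_if_dN3 X by blast
  then have "{x \<in> V - X - A. s x \<notin> V - X} = {}" "{x \<in> V - X - s ` A. p x \<notin> V - X} = {}"
    unfolding closed_def by blast+
  then have "dN3 (V - X) = 0"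
    unfolding dN3_def by (simp only: card.empty)
  then show ?thesis
    using assms d_complement[of X] cut_complement[of V n n X] n X by (auto simp: critical_def)
qed

lemma critical_closed: "critical X \<Longrightarrow> closed X"
  using closed_if_dN3 by (auto simp: critical_def)

text \<open>Otherwise the circuit through \<open>y\<close> is a loop and at most one edge leaves
  \<open>{y}\<close>, against \<open>d_ge_3\<close>.\<close>

lemma s_Y_neq: "s y \<noteq> y" if "y \<in> Y"
proof
  assume *: "s y = y"
  have y: "y \<in> V" using that by (auto simp: Y_def)
  then have "p y = y" using * sp by metis
  then have "{x \<in> {y}. s x \<notin> {y}} = {}" "{x \<in> {y}. p x \<notin> {y}} = {}" "{x \<in> {y}. m x \<notin> {y}} \<subseteq> {y}"
    using * by auto
  then have "d {y} \<le> 1"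
    unfolding d_def cut_def using card_mono[of "{y}" "{x \<in> {y}. m x \<notin> {y}}"]
    by (simp only: card.empty) simp
  moreover have "{y} \<noteq> V"
    using m[OF y] by auto
  ultimately show False
    using d_ge_3[of "{y}"] y by auto
qed

text \<open>\<open>y\<close> is the only missed vertex of its circuit, so its neighbours there are
  covered: \<open>s y\<close> starts an edge of \<open>N\<^sub>2\<close> and \<open>p y\<close> ends
  one, whence they differ.\<close>

lemma Y_neighbours:
  assumes "y \<in> Y"
  shows "s y \<in> A" "p y \<in> s ` A" "s y \<noteq> p y" "p y \<noteq> y"
proof -
  have y: "y \<in> V" "y \<notin> A" "y \<notin> s ` A"
    using assms by (auto simp: Y_def)
  have "s y \<notin> Y"
    using Y_orbit[of y "s y" 1] assms s_Y_neq[OF assms] by auto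
  then show "s y \<in> A"
    using y sp s_in_sA_iff[of y] by (auto simp: Y_def)
  show "p y \<noteq> y"
    using s_Y_neq[OF assms] sp[OF y(1)] by metis
  then have "p y \<notin> Y"
    using Y_orbit[of "p y" y 1] assms sp[OF y(1)] by auto
  then show "p y \<in> s ` A"
    using y sp p_in_A_iff[of y] by (auto simp: Y_def)
  then show "s y \<noteq> p y"
    using A \<open>s y \<in> A\<close> by auto
qed

text \<open>Both circuit edges at an element of \<open>Y\<close> belong to
  \<open>N\<^sub>3\<close>.\<close>

lemma closed_Y_subset:
  assumes "closed Z" "y \<in> Z" "y \<in> Y"
  shows "{p y, y, s y} \<subseteq> Z"
  using assms by (auto simp: closed_def Y_def)

lemma card_nbhd_Y: "y \<in> Y \<Longrightarrow> card {p y, y, s y} = 3"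
  using Y_neighbours[of y] s_Y_neq[of y] by auto

lemma closed_Y_card:
  assumes "Z \<subseteq> V" "closed Z" "y \<in> Z" "y \<in> Y"
  shows "3 \<le> card Z"
  using card_mono[OF finite_sub closed_Y_subset] card_nbhd_Y assms by metis

text \<open>\<open>Z'\<close> makes the complement too large for the third alternative of
  \<open>connectivity\<close>. So \<open>card Z \<le> d Z - 2 \<le> 3\<close>, while closedness puts
  the three vertices around \<open>y\<close> into \<open>Z\<close>.\<close>

lemma small_cell:
  assumes Z: "Z \<subseteq> V" "closed Z" "y \<in> Z" "y \<in> Y" and Z': "Z' \<subseteq> V - Z" "4 \<le> card Z'" and "d Z < 6"
  shows "{p y, y, s y} = Z" "d Z = 5"
proof -
  have "4 \<le> card (V - Z)"
    using Z' card_mono[of "V - Z" Z'] finite_V by auto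
  moreover have "Z \<noteq> V"
    using calculation by auto
  ultimately have le: "card Z + 2 \<le> d Z"
    using connectivity[of Z] Z \<open>d Z < 6\<close> by auto
  then have "card Z = 3" and "d Z = 5"
    using closed_Y_card[OF Z] \<open>d Z < 6\<close> by auto
  then show "{p y, y, s y} = Z" "d Z = 5"
    using card_seteq[OF finite_sub[OF Z(1)] closed_Y_subset[OF Z(2,3,4)]] card_nbhd_Y[OF Z(4)] by auto
qed

text \<open>A closed cell with one element of \<open>Y\<close> has odd size and hence an odd
  boundary. By submodularity the two opposite boundaries sum to at most 12, so one is below 6. The
  other two cells provide the four outside vertices for \<open>small_cell\<close>.\<close>

lemma opposite_cells:
  assumes X: "critical X" "critical X'"
    and y: "(X \<inter> X') \<inter> Y = {a}" "(V - X - X') \<inter> Y = {b}" "(X - X') \<inter> Y \<noteq> {}" "(X' - X) \<inter> Y \<noteq> {}"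
  shows "\<exists>y\<in>{a, b}. {p y, y, s y} \<in> {X \<inter> X', V - X - X'} \<and> d {p y, y, s y} = 5"
proof -
  let ?Z1 = "X \<inter> X'" and ?Z2 = "V - X - X'" and ?Z3 = "X - X'" and ?Z4 = "X' - X"
  have sub: "X \<subseteq> V" "X' \<subseteq> V"
    using X by (auto simp: critical_def)
  have diff: "?Z2 = (V - X) \<inter> (V - X')" "?Z3 = X \<inter> (V - X')" "?Z4 = X' \<inter> (V - X)"
    using sub by auto
  have cl: "closed ?Z1" "closed ?Z2" "closed ?Z3" "closed ?Z4"
    unfolding diff using X critical_closed critical_complement closed_Int by auto
  have "3 \<le> card ?Z3" "3 \<le> card ?Z4"
    using y(3,4) closed_Y_card[of ?Z3] closed_Y_card[of ?Z4] cl sub by blast+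
  then have big: "4 \<le> card (?Z3 \<union> ?Z4)"
    using finite_sub sub by (subst card_Un_disjoint) auto
  have "odd (card (?Z1 \<inter> Y))" "odd (card (?Z2 \<inter> Y))"
    by (simp_all only: y card.insert finite.emptyI empty_iff card.empty) simp_all
  moreover have Z: "?Z1 \<subseteq> V" "?Z2 \<subseteq> V"
    using sub by auto
  ultimately have odd: "odd (d ?Z1)" "odd (d ?Z2)"
    using closed_parity[OF Z(1) cl(1)] closed_parity[OF Z(2) cl(2)] even_d_iff[OF Z(1)] even_d_iff[OF Z(2)]
    by blast+
  have "d ?Z2 = d (X \<union> X')"
  proof -
    have "V - X - X' = V - (X \<union> X')" by blast
    then show ?thesis using d_complement[of "X \<union> X'"] sub by simp
  qed
  then have "d ?Z1 + d ?Z2 \<le> 12"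
    using d_submodular[OF sub] X by (simp add: critical_def)
  moreover have "d ?Z1 \<noteq> 6" "d ?Z2 \<noteq> 6"
    using odd by (metis even_numeral)+
  ultimately consider "d ?Z1 < 6" | "d ?Z2 < 6"
    by linarith
  then show ?thesis
  proof cases
    case 1
    have "a \<in> X \<inter> X' \<inter> Y"
      unfolding y by simp
    then have eq: "{p a, a, s a} = ?Z1" "d ?Z1 = 5"
      by (intro small_cell[OF Z(1) cl(1) _ _ _ big 1]; use sub in blast)+
    show ?thesis
      by (rule bexI[of _ a]) (simp_all only: eq insert_iff simp_thms)
  next
    case 2
    have "b \<in> (V - X - X') \<inter> Y"
      unfolding y by simp
    then have eq: "{p b, b, s b} = ?Z2" "d ?Z2 = 5"
      by (intro small_cell[OF Z(2) cl(2) _ _ _ big 2]; use sub in blast)+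
    show ?thesis
      by (rule bexI[of _ b]) (simp_all only: eq insert_iff simp_thms)
  qed
qed

text \<open>Otherwise at most three steps lead from \<open>y\<close> to \<open>y'\<close>, so
  \<open>y' = y\<close> by \<open>Y_orbit\<close>. Then the circuit is a triangle, with at most
  three boundary edges instead of five.\<close>

lemma s_s_notin_nbhd:
  assumes y: "y \<in> Y" "y' \<in> Y" and d: "d {p y, y, s y} = 5"
  shows "s (s y) \<notin> {p y', y', s y'}"
proof
  assume in_nbhd: "s (s y) \<in> {p y', y', s y'}"
  have V: "y \<in> V" "y' \<in> V" "s y \<in> V" "p y \<in> V" "s (s y) \<in> V"
    using y sp by (auto simp: Y_def)
  have eq: "y' = y"
  proof -
    from in_nbhd consider "s (s y) = p y'" | "s (s y) = y'" | "s (s y) = s y'" by auto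
    then show ?thesis
    proof cases
      case 1
      then have "(s ^^ 3) y = y'"
        using sp[OF V(2)] by (simp add: eval_nat_numeral)
      then show ?thesis using Y_orbit[OF y] by metis
    next
      case 2
      then have "(s ^^ 2) y = y'"
        by (simp add: eval_nat_numeral)
      then show ?thesis using Y_orbit[OF y] by metis
    next
      case 3
      then have "s y = y'"
        using sp[OF V(2)] sp[OF V(3)] by metis
      then have "(s ^^ 1) y = y'" by simp
      then show ?thesis using Y_orbit[OF y] by metis
    qed
  qed
  have "s (s y) \<noteq> y"
    using Y_neighbours[OF y(1)] sp[OF V(3)] sp[OF V(1)] by metis
  moreover have "s (s y) \<noteq> s y"
    using s_Y_neq[OF y(1)] sp V by metis
  ultimately have *: "s (s y) = p y"
    using in_nbhd eq by auto
  then have "p (p y) = s y"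
    using sp V by metis
  then have "{x \<in> {p y, y, s y}. s x \<notin> {p y, y, s y}} = {}" "{x \<in> {p y, y, s y}. p x \<notin> {p y, y, s y}} = {}"
    using * sp V by auto
  then have "d {p y, y, s y} = cut m {p y, y, s y}"
    unfolding d_def cut_def by (simp only: card.empty)
  also have "\<dots> \<le> card {p y, y, s y}"
    unfolding cut_def by (rule card_mono) auto
  finally show False
    using d card_nbhd_Y[OF y(1)] by simp
qed

text \<open>Mirror image of \<open>s_s_notin_nbhd\<close>, to which the case of a triangle is
  reduced.\<close>

lemma p_p_notin_nbhd:
  assumes y: "y \<in> Y" "y' \<in> Y" and d: "d {p y, y, s y} = 5"
  shows "p (p y) \<notin> {p y', y', s y'}"
proof
  assume in_nbhd: "p (p y) \<in> {p y', y', s y'}"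
  have V: "y \<in> V" "y' \<in> V" "s y \<in> V" "p y \<in> V" "p (p y) \<in> V" "p y' \<in> V"
    using y sp by (auto simp: Y_def)
  have y_eq: "s (s (p (p y))) = y"
    using sp V by metis
  have eq: "y' = y"
  proof -
    from in_nbhd consider "p (p y) = p y'" | "p (p y) = y'" | "p (p y) = s y'" by auto
    then show ?thesis
    proof cases
      case 1
      then have "(s ^^ 1) y' = y"
        using y_eq sp[OF V(2)] by simp
      then show ?thesis using Y_orbit[OF y(2) y(1)] by metis
    next
      case 2
      then have "(s ^^ 2) y' = y"
        using y_eq by (simp add: eval_nat_numeral)
      then show ?thesis using Y_orbit[OF y(2) y(1)] by metis
    next
      case 3
      then have "(s ^^ 3) y' = y"
        using y_eq by (simp add: eval_nat_numeral)
      then show ?thesis using Y_orbit[OF y(2) y(1)] by metis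
    qed
  qed
  have "p (p y) \<noteq> y"
    using Y_neighbours[OF y(1)] sp V by metis
  moreover have "p (p y) \<noteq> p y"
    using Y_neighbours[OF y(1)] sp V by metis
  ultimately have "p (p y) = s y"
    using in_nbhd eq by auto
  then have "s (s y) = p y"
    using sp V by metis
  then show False
    using s_s_notin_nbhd[OF y(1) y(1) d] by auto
qed

text \<open>Each of the two pairs of opposite cells contains a path \<open>p y\<close>,
  \<open>y\<close>, \<open>s y\<close>. Its two ends send their \<open>N\<^sub>2\<close> edges out
  of the union of the two paths, which makes four. As a union of adjacent cells, however, this set
  is critical and has only two.\<close>

lemma four_cells:
  assumes X: "critical X" "critical X'"
    and cells: "(X \<inter> X') \<inter> Y = {a}" "(V - X - X') \<inter> Y = {b}" "(X - X') \<inter> Y = {c}" "(X' - X) \<inter> Y = {e}"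
  shows False
proof -
  have sub: "X \<subseteq> V" "X' \<subseteq> V"
    using X by (auto simp: critical_def)
  have abce: "a \<in> Y" "b \<in> Y" "c \<in> Y" "e \<in> Y" "a \<noteq> c" "a \<noteq> e" "b \<noteq> c" "b \<noteq> e"
  proof -
    have "a \<in> X \<inter> X' \<inter> Y" "b \<in> (V - X - X') \<inter> Y" "c \<in> (X - X') \<inter> Y" "e \<in> (X' - X) \<inter> Y"
      unfolding cells by (rule singletonI)+
    then show "a \<in> Y" "b \<in> Y" "c \<in> Y" "e \<in> Y" "a \<noteq> c" "a \<noteq> e" "b \<noteq> c" "b \<noteq> e"
      by blast+
  qed
  obtain y where y: "y \<in> {a, b}" "{p y, y, s y} \<in> {X \<inter> X', V - X - X'}" "d {p y, y, s y} = 5"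
    using opposite_cells[OF X cells(1,2)] unfolding cells by blast
  \<comment> \<open>Replacing \<open>X'\<close> by its complement exchanges the two pairs of
    opposite cells.\<close>
  have "X \<inter> (V - X') = X - X'" "V - X - (V - X') = X' - X" "X - (V - X') = X \<inter> X'" "V - X' - X = V - X - X'"
    using sub by auto
  note diff = this
  obtain z where z: "z \<in> {c, e}" "{p z, z, s z} \<in> {X - X', X' - X}" "d {p z, z, s z} = 5"
    using opposite_cells[of X "V - X'" c e] X(1) critical_complement[OF X(2)]
    unfolding diff cells by blast
  let ?U = "{p y, y, s y} \<union> {p z, z, s z}"
  have "N \<union> M \<in> {X, X', V - X, V - X'}" if "N \<in> {X \<inter> X', V - X - X'}" "M \<in> {X - X', X' - X}" for N M
    using that sub by auto
  from this[OF y(2) z(2)] have "?U \<in> {X, X', V - X, V - X'}" .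
  then have "cut n ?U = 2"
    using X[THEN critical_complement] X by (auto simp only: critical_def)
  have "y \<in> Y" "z \<in> Y" "y \<noteq> z"
    using y z abce by auto
  have n_s: "n (s u) \<notin> ?U" "n (p u) \<notin> ?U" if "u \<in> {y, z}" for u
  proof -
    have u: "u \<in> Y" "d {p u, u, s u} = 5"
      using that y z \<open>y \<in> Y\<close> \<open>z \<in> Y\<close> by auto
    have "n (s u) = s (s u)" "n (p u) = p (p u)"
      using Y_neighbours[OF u(1)] A by (auto simp: n_def)
    then show "n (s u) \<notin> ?U" "n (p u) \<notin> ?U"
      using s_s_notin_nbhd[OF u(1) _ u(2)] p_p_notin_nbhd[OF u(1) _ u(2)] \<open>y \<in> Y\<close> \<open>z \<in> Y\<close> by simp_all
  qed
  have disj: "{p y, y, s y} \<inter> {p z, z, s z} = {}"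
    using y(2) z(2) by blast
  have "x \<in> ?U \<and> n x \<notin> ?U" if "x \<in> {p y, s y} \<union> {p z, s z}" for x
    using that n_s[of y] n_s[of z] by (elim UnE insertE emptyE) (simp_all only: insertI1 insertI2 insert_iff Un_iff simp_thms)
  then have "{p y, s y} \<union> {p z, s z} \<subseteq> {x \<in> ?U. n x \<notin> ?U}"
    by (intro subsetI CollectI)
  then have "card ({p y, s y} \<union> {p z, s z}) \<le> cut n ?U"
    unfolding cut_def by (rule card_mono[rotated]) simp
  moreover have "card ({p y, s y} \<union> {p z, s z}) = 4"
    using disj Y_neighbours(3)[OF \<open>y \<in> Y\<close>] Y_neighbours(3)[OF \<open>z \<in> Y\<close>]
    by (subst card_Un_disjoint) auto
  ultimately show False
    using \<open>cut n ?U = 2\<close> by simp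
qed

section \<open>Existence of a balanced signing\<close>

lemma fourth_elements:
  assumes "card Y = 4" "a \<in> Y"
  obtains b c e where "Y = {a, b, c, e}" "distinct [a, b, c, e]"
proof -
  have "card (Y - {a}) = 3"
    using assms by (simp add: card_Diff_singleton_if)
  then obtain b c e where "Y - {a} = {b, c, e}" "b \<noteq> c" "c \<noteq> e" "b \<noteq> e"
    by (auto simp: card_3_iff)
  moreover then have "Y = {a, b, c, e}" "a \<noteq> b" "a \<noteq> c" "a \<noteq> e"
    using assms(2) by blast+
  ultimately show thesis
    using that[of b c e] by simp
qed

text \<open>The pairing \<open>q\<close> replaces the fixed points of \<open>n\<close>, giving a
  second fixed-point-free involution for \<open>two_involutions_signing\<close>.\<close>

lemma signing_exists:
  assumes q: "\<And>y. y \<in> Y \<Longrightarrow> q y \<in> Y \<and> q y \<noteq> y \<and> q (q y) = y"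
  obtains w where "signing w" "\<And>y. y \<in> Y \<Longrightarrow> w (q y) = - w y"
proof -
  define n' where "n' x = (if x \<in> Y then q x else n x)" for x
  have YV: "Y \<subseteq> V" by (auto simp: Y_def)
  have "n' x \<in> V \<and> n' x \<noteq> x \<and> n' (n' x) = x" if "x \<in> V" for x
    using that q[of x] n[of x] n_Y_iff[of x] n_neq[of x] YV unfolding n'_def by auto
  then obtain w :: "'v \<Rightarrow> int" where w: "\<forall>x\<in>V. w x \<in> {1, -1} \<and> w (m x) = - w x \<and> w (n' x) = - w x"
    using two_involutions_signing[OF finite_V, of m n'] m by blast
  then have "signing w" "\<And>y. y \<in> Y \<Longrightarrow> w (q y) = - w y"
    using YV unfolding signing_def n'_def by (auto split: if_splits)
  then show thesis by (rule that)
qed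

text \<open>A balanced valuation in one-sided form: \<open>m\<close> makes the total weight 0 and
  \<open>d\<close> is invariant under complements, so the inequality for \<open>V - X\<close> bounds
  \<open>- sum w X\<close>.\<close>

definition balanced :: "('v \<Rightarrow> int) \<Rightarrow> bool" where
  "balanced w \<longleftrightarrow> signing w \<and> (\<forall>X \<subseteq> V. 5 * sum w X \<le> 3 * int (d X))"

lemma finite_Y: "finite Y"
  by (rule finite_sub) (auto simp: Y_def)

lemma signing_Y: "signing w \<Longrightarrow> y \<in> Y \<Longrightarrow> w y = 1 \<or> w y = - 1"
  by (auto simp: signing_def Y_def)

text \<open>The weight of \<open>Y\<close> is 0, so \<open>sum w Z\<close> is bounded both by the
  size of \<open>Z\<close> and by that of \<open>Y - Z\<close>; add the two bounds.\<close>

lemma sum_Y_le: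
  assumes w: "signing w" and q: "\<And>y. y \<in> Y \<Longrightarrow> q y \<in> Y \<and> q (q y) = y" "\<And>y. y \<in> Y \<Longrightarrow> w (q y) = - w y"
    and Z: "Z \<subseteq> Y"
  shows "2 * sum w Z \<le> int (card Y)"
proof -
  have "sum w Y = 0"
    by (rule sum_antisymmetric_involution[of _ q]) (use q in auto)
  then have "sum w Z = - sum w (Y - Z)"
    using sum.subset_diff[OF Z finite_Y, of w] by simp
  moreover have "sum w Z \<le> of_nat (card Z) * 1" "sum (\<lambda>y. - w y) (Y - Z) \<le> of_nat (card (Y - Z)) * 1"
    by (rule sum_bounded_above; use signing_Y[OF w] Z in force)+
  moreover have "card Y = card Z + card (Y - Z)"
    using Z finite_Y by (metis card_Diff_subset card_mono finite_subset le_add_diff_inverse)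
  ultimately show ?thesis
    by (simp add: sum_negf)
qed

text \<open>Pair \<open>a\<close> with \<open>b\<close> and \<open>c\<close> with \<open>e\<close>.
  A set of weight 2 on \<open>Y\<close> must contain both positive elements and no negative one, so
  it separates both pairs.\<close>

lemma balanced_or_critical:
  assumes Y: "Y = {a, b, c, e}" "distinct [a, b, c, e]"
  shows "(\<exists>w. balanced w) \<or> (\<exists>X. critical X \<and>
    (a \<in> X \<longleftrightarrow> b \<notin> X) \<and> (c \<in> X \<longleftrightarrow> e \<notin> X))"
proof -
  define q where "q = (\<lambda>y. if y = a then b else if y = b then a else if y = c then e else c)"
  have q: "q y \<in> Y \<and> q y \<noteq> y \<and> q (q y) = y" if "y \<in> Y" for y
    using that Y by (auto simp: q_def)
  obtain w where w: "signing w" "\<And>y. y \<in> Y \<Longrightarrow> w (q y) = - w y"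
    using signing_exists[of q] q by blast
  show ?thesis
  proof (cases "balanced w")
    case False
    then obtain X where X: "X \<subseteq> V" "3 * int (d X) < 5 * sum w X"
      using w(1) unfolding balanced_def by (meson not_le)
    have "card Y = 4"
      using Y by simp
    then have "sum w (X \<inter> Y) \<le> 2"
      using sum_Y_le[of w q "X \<inter> Y"] w q by force
    then have crit: "critical X" "sum w (X \<inter> Y) = 2"
      using unbalanced_imp_critical[OF w(1) X(1) _ X(2)] by auto
    have "w b = - w a" "w e = - w c"
      using w(2)[of a] w(2)[of c] Y by (auto simp: q_def)
    moreover have "w a = 1 \<or> w a = - 1" "w c = 1 \<or> w c = - 1"
      using signing_Y[OF w(1)] Y(1) by auto
    moreover have "sum w (X \<inter> Y) = (\<Sum>y\<in>Y. if y \<in> X then w y else 0)"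
      using finite_Y by (simp add: sum.If_cases Int_commute)
    then have "2 = (if a \<in> X then w a else 0) + (if b \<in> X then w b else 0) +
        (if c \<in> X then w c else 0) + (if e \<in> X then w e else 0)"
      using Y crit(2) by simp
    ultimately show ?thesis
      using crit(1) by (intro disjI2 exI[of _ X]) (auto split: if_splits)
  qed blast
qed

text \<open>\<open>card Y\<close> is even. With at most two elements the weight on \<open>Y\<close>
  is at most 1, whereas a violation requires 2. With four, a critical \<open>X\<close> for one
  pairing splits \<open>Y\<close> two and two; pairing along its sides yields a critical
  \<open>X'\<close> crossing \<open>X\<close>, which \<open>four_cells\<close> excludes.\<close>

theorem balanced_exists:
  assumes "card Y \<le> 4"
  obtains w where "balanced w"
proof -
  have even: "even (card Y)"
  proof -
    have "closed V"
      using sp by (auto simp: closed_def)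
    then have "even (card V) \<longleftrightarrow> even (card (V \<inter> Y))"
      using closed_parity by blast
    moreover have "even (card V)"
      by (rule even_card_involution[OF finite_V]) (rule m)
    moreover have "V \<inter> Y = Y"
      by (auto simp: Y_def)
    ultimately show ?thesis by simp
  qed
  then have odd_values: "card Y \<noteq> 1" "card Y \<noteq> 3"
    by (metis odd_one, metis odd_numeral)
  then consider "card Y \<le> 2" | "card Y = 4"
    using assms by linarith
  then show thesis
  proof cases
    case 1
    obtain q where q: "\<And>y. y \<in> Y \<Longrightarrow> q y \<in> Y \<and> q y \<noteq> y \<and> q (q y) = y"
    proof (cases "card Y = 2")
      case True
      then obtain a b where "Y = {a, b}" "a \<noteq> b"
        by (auto simp: card_2_iff)
      then show ?thesis
        by (intro that[of "\<lambda>y. if y = a then b else a"]) auto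
    next
      case False
      then have "Y = {}"
        using 1 odd_values(1) finite_Y card_gt_0_iff[of Y] by linarith
      then show ?thesis
        by (intro that[of id]) auto
    qed
    obtain w where w: "signing w" "\<And>y. y \<in> Y \<Longrightarrow> w (q y) = - w y"
      using signing_exists[of q] q by blast
    have "5 * sum w X \<le> 3 * int (d X)" if X: "X \<subseteq> V" for X
    proof (rule ccontr)
      assume *: "\<not> ?thesis"
      have "2 * sum w (X \<inter> Y) \<le> 2"
        using sum_Y_le[of w q "X \<inter> Y"] w q 1 by force
      then show False
        using unbalanced_imp_critical[OF w(1) X] * by force
    qed
    then show ?thesis
      using that w(1) by (auto simp: balanced_def)
  next
    case 2
    then obtain a b c e where Y: "Y = {a, b, c, e}" "distinct [a, b, c, e]"
      using fourth_elements by (metis card.empty equals0I zero_neq_numeral)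
    show ?thesis
    proof (rule ccontr)
      assume "\<not> thesis"
      then have none: "\<not> (\<exists>w. balanced w)"
        using that by blast
      then obtain X where X: "critical X" "a \<in> X \<longleftrightarrow> b \<notin> X" "c \<in> X \<longleftrightarrow> e \<notin> X"
        using balanced_or_critical[OF Y] by blast
      have impossible: False
        if Y': "Y = {a, b, c, e}" "distinct [a, b, c, e]" and ab: "a \<in> X" "b \<in> X" "c \<notin> X" "e \<notin> X" for a b c e
      proof -
        obtain X' where X': "critical X'" "a \<in> X' \<longleftrightarrow> b \<notin> X'" "c \<in> X' \<longleftrightarrow> e \<notin> X'"
          using balanced_or_critical[OF Y'] none by blast
        have YV: "Y \<subseteq> V" by (auto simp: Y_def)
        \<comment> \<open>\<open>a'\<close> and \<open>c'\<close> are the elements of the two pairs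
          inside \<open>X'\<close>, \<open>b'\<close> and \<open>e'\<close> those outside.\<close>
        define a' where "a' = (if a \<in> X' then a else b)"
        define b' where "b' = (if a \<in> X' then b else a)"
        define c' where "c' = (if c \<in> X' then c else e)"
        define e' where "e' = (if c \<in> X' then e else c)"
        have "X \<inter> X' \<inter> Y = {a'}" "(X - X') \<inter> Y = {b'}" "(X' - X) \<inter> Y = {c'}" "(V - X - X') \<inter> Y = {e'}"
          using Y' ab X' YV by (auto simp: a'_def b'_def c'_def e'_def)
        then show False
          using four_cells[OF X(1) X'(1), of a' e' b' c'] by simp
      qed
      \<comment> \<open>\<open>X\<close> contains one element of each pair; each of the four lists
        begins with one such choice.\<close>
      have perm: "Y = {a, c, b, e}" "Y = {a, e, b, c}" "Y = {b, c, a, e}" "Y = {b, e, a, c}"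
        by (simp_all add: Y(1) insert_commute)
      have dist: "distinct [a, c, b, e]" "distinct [a, e, b, c]" "distinct [b, c, a, e]" "distinct [b, e, a, c]"
        using Y(2) by auto
      show False
        using impossible[OF perm(1) dist(1)] impossible[OF perm(2) dist(2)]
          impossible[OF perm(3) dist(3)] impossible[OF perm(4) dist(4)] X(2,3) by argo
    qed
  qed
qed

end

section \<open>Cubic graphs\<close>

lemma degree_eq:
  assumes "finite (edges G)" "\<And>e. e \<in> edges G \<Longrightarrow> ends G e = {t e, h e}"
  shows "degree G v = card {e \<in> edges G. t e = v} + card {e \<in> edges G. h e = v}"
proof -
  have "{e \<in> edges G. v \<in> ends G e} = {e \<in> edges G. t e = v} \<union> {e \<in> edges G. h e = v}"
    "{e \<in> edges G. ends G e = {v}} = {e \<in> edges G. t e = v} \<inter> {e \<in> edges G. h e = v}"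
    using assms(2) by auto
  then show ?thesis
    unfolding degree_def using assms(1)
      card_Un_Int[of "{e \<in> edges G. t e = v}" "{e \<in> edges G. h e = v}"] by simp
qed

lemma edge_boundary_eq:
  assumes "\<And>e. e \<in> edges G \<Longrightarrow> ends G e = {t e, h e}"
  shows "edge_boundary G S = {e \<in> edges G. t e \<in> S \<and> h e \<notin> S} \<union> {e \<in> edges G. h e \<in> S \<and> t e \<notin> S}"
  using assms unfolding edge_boundary_def by (auto simp: doubleton_eq_iff)

lemma sum_card_fibres:
  assumes "finite E" "finite S"
  shows "(\<Sum>v\<in>S. card {e \<in> E. g e = v}) = card {e \<in> E. g e \<in> S}"
proof -
  have "{e \<in> E. g e \<in> S} = (\<Union>v\<in>S. {e \<in> E. g e = v})"
    by auto
  then show ?thesis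
    using assms by (simp only:) (subst card_UN_disjoint, auto)
qed

context fin_multigraph
begin

lemma finite_sub_edges [simp]: "finite {e \<in> edges G. P e}"
  using finite_edges by simp

lemma ends_pair:
  assumes "e \<in> edges G"
  obtains u v where "ends G e = {u, v}"
proof -
  have "card (ends G e) = 1 \<or> card (ends G e) = 2"
    using card_ends[OF assms] by simp
  then show thesis
    using that by (metis card_1_singletonE card_2_iff insert_absorb2)
qed

lemma orientation_exists:
  obtains t h where "\<And>e. e \<in> edges G \<Longrightarrow> ends G e = {t e, h e}"
    "t ` edges G \<subseteq> vertices G" "h ` edges G \<subseteq> vertices G"
proof -
  have "\<forall>e\<in>edges G. \<exists>p. ends G e = {fst p, snd p}"
  proof
    fix e assume "e \<in> edges G"
    then obtain u v where "ends G e = {u, v}"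
      by (rule ends_pair)
    then show "\<exists>p. ends G e = {fst p, snd p}"
      by (intro exI[of _ "(u, v)"]) simp
  qed
  then obtain p where p: "\<And>e. e \<in> edges G \<Longrightarrow> ends G e = {fst (p e), snd (p e)}"
    by metis
  show thesis
  proof (rule that[of "fst \<circ> p" "snd \<circ> p"])
    show "(fst \<circ> p) ` edges G \<subseteq> vertices G" "(snd \<circ> p) ` edges G \<subseteq> vertices G"
      using p ends_in_vertices by fastforce+
  qed (use p in simp)
qed

lemma edge_boundary_complement:
  assumes "S \<subseteq> vertices G"
  shows "edge_boundary G (vertices G - S) = edge_boundary G S"
proof -
  obtain t h where th: "\<And>e. e \<in> edges G \<Longrightarrow> ends G e = {t e, h e}"
    "t ` edges G \<subseteq> vertices G" "h ` edges G \<subseteq> vertices G"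
    by (rule orientation_exists) blast
  note eq = edge_boundary_eq[of G t h, OF th(1)]
  show ?thesis
    by (simp only: eq) (use th(2,3) in auto)
qed

lemma handshake:
  assumes "finite S"
  shows "(\<Sum>v\<in>S. degree G v) = 2 * card {e \<in> edges G. ends G e \<subseteq> S} + card (edge_boundary G S)"
proof -
  obtain t h where th: "\<And>e. e \<in> edges G \<Longrightarrow> ends G e = {t e, h e}"
    by (rule orientation_exists) blast
  let ?in = "{e \<in> edges G. ends G e \<subseteq> S}"
  let ?o = "{e \<in> edges G. t e \<in> S \<and> h e \<notin> S}" and ?i = "{e \<in> edges G. h e \<in> S \<and> t e \<notin> S}"
  have "(\<Sum>v\<in>S. degree G v) = card {e \<in> edges G. t e \<in> S} + card {e \<in> edges G. h e \<in> S}"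
    by (simp add: degree_eq[OF finite_edges th] sum.distrib sum_card_fibres[OF finite_edges assms])
  moreover have "{e \<in> edges G. t e \<in> S} = ?in \<union> ?o" "{e \<in> edges G. h e \<in> S} = ?in \<union> ?i"
    using th by auto
  moreover have "?in \<inter> ?o = {}" "?in \<inter> ?i = {}" "?o \<inter> ?i = {}"
    using th by auto
  moreover have "edge_boundary G S = ?o \<union> ?i"
    using edge_boundary_eq[of G t h S, OF th] by simp
  ultimately show ?thesis
    by (simp add: card_Un_disjoint)
qed

definition dense_part :: "'v set \<Rightarrow> 'e set \<Rightarrow> bool" where
  "dense_part W F \<longleftrightarrow> W \<subseteq> vertices G \<and> W \<noteq> {} \<and> F \<subseteq> edges G \<and> (\<forall>e\<in>F. ends G e \<subseteq> W) \<and> card W \<le> card F"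

text \<open>A minimal nonempty subgraph with at least as many edges as vertices is a circuit.\<close>

lemma contains_circuit_if_dense:
  assumes "vertices G \<noteq> {}" "card (vertices G) \<le> card (edges G)"
  shows "contains_circuit G"
proof -
  have "dense_part (vertices G) (edges G)"
    using assms ends_in_vertices by (auto simp: dense_part_def)
  then obtain p where "case_prod dense_part p"
    and "\<And>q. case_prod dense_part q \<Longrightarrow> card (fst p) + card (snd p) \<le> card (fst q) + card (snd q)"
    using ex_has_least_nat[of "case_prod dense_part" "(vertices G, edges G)" "\<lambda>p. card (fst p) + card (snd p)"]
    by auto
  then obtain W F where dense: "dense_part W F"
    and min: "\<And>W' F'. dense_part W' F' \<Longrightarrow> card W + card F \<le> card W' + card F'"
    by (cases p) fastforce
  have W: "W \<subseteq> vertices G" "W \<noteq> {}" and F: "F \<subseteq> edges G" "\<And>e. e \<in> F \<Longrightarrow> ends G e \<subseteq> W" and le: "card W \<le> card F"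
    using dense by (auto simp: dense_part_def)
  have fin: "finite W" "finite F"
    using W F finite_vertices finite_edges finite_subset by blast+
  define C where "C = G\<lparr>vertices := W, edges := F\<rparr>"
  have C: "vertices C = W" "edges C = F" "ends C = ends G"
    by (simp_all add: C_def)
  interpret C: fin_multigraph C
    by unfold_locales (use fin F card_ends in \<open>auto simp: C\<close>)
  \<comment> \<open>A surplus edge could be deleted, against minimality.\<close>
  have eq: "card F = card W"
  proof (rule ccontr)
    assume "card F \<noteq> card W"
    then have less: "card W < card F" using le by simp
    then obtain e where "e \<in> F" by (metis card.empty equals0I not_less0)
    then have "dense_part W (F - {e})"
      using dense less fin by (auto simp: dense_part_def)
    then show False
      using min[of W "F - {e}"] card_Diff1_less[OF fin(2) \<open>e \<in> F\<close>] by simp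
  qed
  \<comment> \<open>A vertex of degree at most 1 could be deleted together with its edge.\<close>
  have deg_ge: "2 \<le> degree C v" if v: "v \<in> W" for v
  proof (rule ccontr)
    assume "\<not> ?thesis"
    then have small: "card {e \<in> F. v \<in> ends G e} + card {e \<in> F. ends G e = {v}} \<le> 1"
      by (simp add: degree_def C)
    have loop: "ends G e \<noteq> {v}" if "e \<in> F" for e
    proof
      assume "ends G e = {v}"
      then have "{e \<in> F. v \<in> ends G e} \<noteq> {}" "{e \<in> F. ends G e = {v}} \<noteq> {}"
        using \<open>e \<in> F\<close> by auto
      then have "card {e \<in> F. v \<in> ends G e} \<noteq> 0" "card {e \<in> F. ends G e = {v}} \<noteq> 0"
        using fin by auto
      then show False using small by linarith
    qed
    have "W \<noteq> {v}"
    proof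
      assume "W = {v}"
      then have "card F \<noteq> 0" using le by auto
      then obtain e where e: "e \<in> F" by (metis card.empty equals0I)
      then have "ends G e \<subseteq> {v}" using F(2) \<open>W = {v}\<close> by auto
      moreover have "ends G e \<noteq> {}" using card_ends[of e] e F(1) by auto
      ultimately show False using loop[OF e] by blast
    qed
    let ?F = "F - {e \<in> F. v \<in> ends G e}"
    have "card ?F = card F - card {e \<in> F. v \<in> ends G e}"
      using fin by (subst card_Diff_subset) auto
    then have "card (W - {v}) \<le> card ?F"
      using small eq v fin by simp
    moreover have "ends G e \<subseteq> W - {v}" if "e \<in> ?F" for e
      using that F(2) by blast
    ultimately have "dense_part (W - {v}) ?F"
      using W F \<open>W \<noteq> {v}\<close> v unfolding dense_part_def by blast
    then have "card W + card F \<le> card (W - {v}) + card ?F"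
      by (rule min)
    moreover have "card (W - {v}) < card W" "card ?F \<le> card F"
      using card_Diff1_less[OF fin(1) v] card_mono[OF fin(2), of ?F] by blast+
    ultimately show False by linarith
  qed
  have "edge_boundary C W = {}"
    using F by (auto simp: edge_boundary_def C)
  moreover have "{e \<in> F. ends G e \<subseteq> W} = F"
    using F by auto
  ultimately have total: "(\<Sum>v\<in>W. degree C v) = 2 * card W"
    using C.handshake[of W] fin eq by (simp add: C)
  have "degree C v = 2" if v: "v \<in> W" for v
  proof (rule ccontr)
    assume "degree C v \<noteq> 2"
    then have "(\<Sum>v\<in>W. 2) < (\<Sum>v\<in>W. degree C v)"
      using deg_ge v fin by (intro sum_strict_mono_ex1) (auto intro!: bexI[of _ v] simp: le_neq_implies_less)
    then show False using total by simp
  qed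
  then have "regular 2 C"
    by (simp add: regular_def C)
  moreover have "connected_graph C"
    unfolding connected_graph_def
  proof (intro conjI ballI)
    show "vertices C \<noteq> {}" using W by (simp add: C)
    fix u v assume uv: "u \<in> vertices C" "v \<in> vertices C"
    let ?r = "{(x, y). \<exists>e \<in> edges C. ends C e = {x, y}}"
    define R where "R = {x. (u, x) \<in> ?r\<^sup>*}"
    have step: "y \<in> R" if "x \<in> R" "(x, y) \<in> ?r" for x y
      using that unfolding R_def by (simp add: rtrancl.rtrancl_into_rtrancl)
    have RW: "R \<subseteq> W"
    proof
      fix x assume "x \<in> R"
      then have "(u, x) \<in> ?r\<^sup>*" by (simp add: R_def)
      then show "x \<in> W"
        by (induction rule: rtrancl_induct) (use uv F in \<open>auto simp: C\<close>)
    qed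
    have "u \<in> R" by (simp add: R_def)
    show "(u, v) \<in> ?r\<^sup>*"
    proof (rule ccontr)
      assume "(u, v) \<notin> ?r\<^sup>*"
      then have "v \<notin> R" by (simp add: R_def)
      let ?F1 = "{e \<in> F. ends G e \<subseteq> R}" and ?F2 = "{e \<in> F. ends G e \<subseteq> W - R}"
      have "e \<in> ?F1 \<union> ?F2" if e: "e \<in> F" for e
      proof -
        obtain x y where xy: "ends G e = {x, y}"
          using ends_pair[of e] e F(1) by blast
        then have "(x, y) \<in> ?r" "(y, x) \<in> ?r"
          using e by (auto simp: C insert_commute)
        then have "x \<in> R \<longleftrightarrow> y \<in> R" using step by blast
        then show ?thesis using e xy F(2)[OF e] by auto
      qed
      then have "F = ?F1 \<union> ?F2" by blast
      moreover have "?F1 \<inter> ?F2 = {}"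
      proof -
        have "ends G e \<noteq> {}" if "e \<in> F" for e
          using that F(1) card_ends[of e] by auto
        then show ?thesis by blast
      qed
      ultimately have cF: "card F = card ?F1 + card ?F2"
        using fin by (metis (no_types, lifting) card_Un_disjoint finite_Un)
      have cW: "card W = card R + card (W - R)"
        using RW fin by (metis card_Diff_subset card_mono finite_subset le_add_diff_inverse)
      have lt: "card R < card W" "card (W - R) < card W"
        using \<open>v \<notin> R\<close> \<open>u \<in> R\<close> uv RW fin by (auto simp: C intro!: psubset_card_mono)
      have le': "card ?F1 \<le> card F" "card ?F2 \<le> card F"
        using fin by (auto intro!: card_mono)
      have "card R \<le> card ?F1 \<or> card (W - R) \<le> card ?F2"
        using cF cW eq by linarith
      then show False
      proof
        assume "card R \<le> card ?F1"
        then have "dense_part R ?F1"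
          unfolding dense_part_def using RW W F \<open>u \<in> R\<close> by blast
        then show False using min[of R ?F1] lt le' by linarith
      next
        assume "card (W - R) \<le> card ?F2"
        then have "dense_part (W - R) ?F2"
          unfolding dense_part_def using W F \<open>v \<notin> R\<close> uv by (auto simp: C)
        then show False using min[of "W - R" ?F2] lt le' by linarith
      qed
    qed
  qed
  ultimately have "circuit C"
    by (simp add: circuit_def)
  moreover have "subgraph C G"
    using W F by (simp add: subgraph_def C)
  ultimately show ?thesis
    unfolding contains_circuit_def by blast
qed

lemma induced_fin:
  assumes "S \<subseteq> vertices G"
  shows "fin_multigraph (induced_subgraph G S)"
proof
  show "finite (vertices (induced_subgraph G S))"
    using finite_subset[OF assms finite_vertices] by (simp add: induced_subgraph_def)
qed (use finite_edges card_ends in \<open>auto simp: induced_subgraph_def\<close>)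

end

locale cyclically_6_connected_cubic = fin_multigraph G for G :: "('v, 'e) multigraph" +
  assumes cubic: "cubic G" and cyclically_6: "cyclically_edge_connected 6 G"
begin

lemma degree_3: "v \<in> vertices G \<Longrightarrow> degree G v = 3"
  using cubic by (auto simp: cubic_def regular_def)

lemma handshake_cubic:
  assumes "S \<subseteq> vertices G"
  shows "3 * card S = 2 * card {e \<in> edges G. ends G e \<subseteq> S} + card (edge_boundary G S)"
proof -
  have "(\<Sum>v\<in>S. degree G v) = (\<Sum>v\<in>S. 3)"
    by (rule sum.cong) (use assms degree_3 in auto)
  then show ?thesis
    using handshake[OF finite_subset[OF assms finite_vertices]] by simp
qed

text \<open>A nonempty set without circuits spans at most \<open>card S - 1\<close> edges, so at
  least \<open>3 * card S - 2 * (card S - 1)\<close> edges leave it.\<close>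

lemma acyclic_boundary:
  assumes "S \<subseteq> vertices G" "S \<noteq> {}" "\<not> contains_circuit (induced_subgraph G S)"
  shows "card S + 2 \<le> card (edge_boundary G S)"
proof -
  interpret S: fin_multigraph "induced_subgraph G S"
    by (rule induced_fin[OF assms(1)])
  have "card {e \<in> edges G. ends G e \<subseteq> S} < card S"
    using S.contains_circuit_if_dense assms(2,3) by (auto simp: induced_subgraph_def not_le)
  then show ?thesis
    using handshake_cubic[OF assms(1)] by linarith
qed

lemma boundary_alternatives:
  assumes S: "S \<subseteq> vertices G" "S \<noteq> {}" "S \<noteq> vertices G"
  shows "6 \<le> card (edge_boundary G S) \<or> card S + 2 \<le> card (edge_boundary G S) \<or>
    card (vertices G - S) + 2 \<le> card (edge_boundary G S)"
proof (cases "contains_circuit (induced_subgraph G S) \<and> contains_circuit (induced_subgraph G (vertices G - S))")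
  case True
  then have "\<not> card (edge_boundary G S) < 6"
    using cyclically_6 S(1) unfolding cyclically_edge_connected_def by blast
  then show ?thesis by simp
next
  case False
  then show ?thesis
    using acyclic_boundary[of S] acyclic_boundary[of "vertices G - S"] edge_boundary_complement[OF S(1)] S
    by auto
qed

definition adj :: "'v \<Rightarrow> 'v \<Rightarrow> bool" where
  "adj u v \<longleftrightarrow> u \<noteq> v \<and> (\<exists>e \<in> edges G. ends G e = {u, v})"

text \<open>Petersen's argument: an odd set has an odd boundary, here of at least three edges by
  connectivity. The boundaries of the members of \<open>K\<close> are disjoint and all end in
  \<open>S\<close>, at which at most \<open>3 * card S\<close> edges leave.\<close>

lemma perfect_matching_exists: "\<exists>m. perfect_matching adj (vertices G) m"
proof (rule tutte[OF finite_vertices])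
  show "adj y x" if "adj x y" for x y
    using that by (auto simp: adj_def insert_commute)
  fix S K assume sep: "odd_separation adj (vertices G) S K"
  have S: "S \<subseteq> vertices G" and finK: "finite K"
    using sep odd_separation_finite[OF finite_vertices sep] by (auto simp: odd_separation_def)
  have bd: "\<exists>u v. ends G e = {u, v} \<and> u \<in> C \<and> u \<notin> S \<and> v \<in> S" if C: "C \<in> K" and e: "e \<in> edge_boundary G C" for C e
  proof -
    obtain u v where uv: "e \<in> edges G" "ends G e = {u, v}" "u \<in> C" "v \<notin> C"
      using e by (auto simp: edge_boundary_def)
    then have "adj u v" "v \<in> vertices G"
      using ends_in_vertices by (auto simp: adj_def)
    then have "v \<in> S" "u \<notin> S"
      using sep C uv unfolding odd_separation_def by blast+
    then show ?thesis using uv by blast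
  qed
  have three: "3 \<le> card (edge_boundary G C)" if C: "C \<in> K" for C
  proof -
    have CV: "C \<subseteq> vertices G" and odd: "odd (card C)"
      using sep C unfolding odd_separation_def by blast+
    then have "odd (card (edge_boundary G C))"
      using handshake_cubic[OF CV] by (metis even_add even_mult_iff odd_numeral dvd_triv_left)
    moreover then have "edge_boundary G C \<noteq> {}"
      by (metis card.empty even_zero)
    then have "C \<noteq> {}" "C \<noteq> vertices G"
      using ends_in_vertices by (auto simp: edge_boundary_def)
    then have "1 \<le> card C" "1 \<le> card (vertices G - C)"
      using CV finite_vertices finite_subset[OF CV] by (auto simp: Suc_le_eq card_gt_0_iff)
    then show ?thesis
      using boundary_alternatives[OF CV] \<open>C \<noteq> {}\<close> \<open>C \<noteq> vertices G\<close> by auto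
  qed
  have disj: "edge_boundary G C \<inter> edge_boundary G D = {}" if CD: "C \<in> K" "D \<in> K" "C \<noteq> D" for C D
  proof (rule ccontr)
    assume "edge_boundary G C \<inter> edge_boundary G D \<noteq> {}"
    then obtain e where "e \<in> edge_boundary G C" "e \<in> edge_boundary G D" by blast
    then obtain u v u' v' where "{u, v} = {u', v'}" "u \<in> C" "u \<notin> S" "v \<in> S" "u' \<in> D" "u' \<notin> S" "v' \<in> S"
      using bd[OF CD(1)] bd[OF CD(2)] by metis
    then have "u \<in> C \<inter> D" by (auto simp: doubleton_eq_iff)
    moreover have "disjnt C D"
      using sep CD unfolding odd_separation_def pairwise_def by blast
    ultimately show False by (auto simp: disjnt_def)
  qed
  have "3 * card K = (\<Sum>C\<in>K. 3)" by simp
  also have "\<dots> \<le> (\<Sum>C\<in>K. card (edge_boundary G C))"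
    by (rule sum_mono) (rule three)
  also have "\<dots> = card (\<Union>C\<in>K. edge_boundary G C)"
    by (rule card_UN_disjoint[symmetric]) (use finK disj in \<open>auto simp: edge_boundary_def\<close>)
  also have "\<dots> \<le> card (edge_boundary G S)"
  proof (rule card_mono)
    show "finite (edge_boundary G S)" by (simp add: edge_boundary_def)
    show "(\<Union>C\<in>K. edge_boundary G C) \<subseteq> edge_boundary G S"
    proof
      fix e assume "e \<in> (\<Union>C\<in>K. edge_boundary G C)"
      then obtain C where C: "C \<in> K" "e \<in> edge_boundary G C" by blast
      then obtain u v where "ends G e = {v, u}" "v \<in> S" "u \<notin> S"
        using bd[OF C] by (auto simp: insert_commute)
      moreover have "e \<in> edges G"
        using C by (auto simp: edge_boundary_def)
      ultimately show "e \<in> edge_boundary G S"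
        unfolding edge_boundary_def by blast
    qed
  qed
  also have "\<dots> \<le> 3 * card S"
    using handshake_cubic[OF S] by simp
  finally show "card K \<le> card S" by simp
qed

text \<open>The complement of a perfect matching. Its existence makes the minimum in
  \<open>oddness\<close> attained.\<close>

lemma two_factor_exists: "\<exists>F. two_factor F G"
proof -
  obtain m where m: "\<And>x. x \<in> vertices G \<Longrightarrow> m x \<in> vertices G \<and> m x \<noteq> x \<and> m (m x) = x \<and> adj x (m x)"
    using perfect_matching_exists unfolding perfect_matching_def by blast
  \<comment> \<open>The choice depends only on the set \<open>{x, m x}\<close>, so both ends select
    the same one among parallel edges.\<close>
  define g where "g x = (SOME e. e \<in> edges G \<and> ends G e = {x, m x})" for x
  have g: "g x \<in> edges G \<and> ends G (g x) = {x, m x}" if "x \<in> vertices G" for x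
    unfolding g_def by (rule someI_ex) (use m[OF that] in \<open>auto simp: adj_def\<close>)
  have g_m: "g (m x) = g x" if "x \<in> vertices G" for x
    using m[OF that] by (simp add: g_def insert_commute)
  define F where "F = G\<lparr>edges := edges G - g ` vertices G\<rparr>"
  have F: "vertices F = vertices G" "edges F = edges G - g ` vertices G" "ends F = ends G"
    by (simp_all add: F_def)
  have "degree F v = 2" if v: "v \<in> vertices G" for v
  proof -
    have "e = g v" if "e \<in> g ` vertices G" "v \<in> ends G e" for e
      using that g g_m v by auto
    then have "{e \<in> edges G. v \<in> ends G e} = insert (g v) {e \<in> edges F. v \<in> ends G e}"
      using g v by (auto simp: F)
    then have "card {e \<in> edges G. v \<in> ends G e} = Suc (card {e \<in> edges F. v \<in> ends G e})"
      using v finite_edges by (simp add: F)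
    moreover have "{e \<in> edges G. ends G e = {v}} = {e \<in> edges F. ends G e = {v}}"
      using g m by (force simp: F)
    ultimately show ?thesis
      using degree_3[OF v] by (simp add: degree_def F)
  qed
  then have "two_factor F G"
    using ends_in_vertices by (auto simp: two_factor_def subgraph_def regular_def F)
  then show ?thesis ..
qed

end

section \<open>Circuits of a 2-factor\<close>

text \<open>Forward iterates only; in a finite permutation they already form the whole
  cycle.\<close>

definition orb :: "('v \<Rightarrow> 'v) \<Rightarrow> 'v \<Rightarrow> 'v set" where
  "orb s x = range (\<lambda>k. (s ^^ k) x)"

locale finite_permutation =
  fixes V :: "'v set" and s p :: "'v \<Rightarrow> 'v"
  assumes finite_V: "finite V"
    and sp: "x \<in> V \<Longrightarrow> s x \<in> V \<and> p x \<in> V \<and> p (s x) = x \<and> s (p x) = x"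
begin

lemma pow_in: "x \<in> V \<Longrightarrow> (s ^^ k) x \<in> V"
  by (induction k) (use sp in auto)

lemma pow_inj: "x \<in> V \<Longrightarrow> y \<in> V \<Longrightarrow> (s ^^ k) x = (s ^^ k) y \<Longrightarrow> x = y"
proof (induction k)
  case (Suc k)
  then have "s ((s ^^ k) x) = s ((s ^^ k) y)" by simp
  then have "(s ^^ k) x = (s ^^ k) y"
    using sp pow_in Suc.prems(1,2) by metis
  then show ?case using Suc by blast
qed simp

lemma self_in_orb: "x \<in> orb s x"
  unfolding orb_def by (rule range_eqI[of _ _ 0]) simp

lemma orb_subset: "x \<in> V \<Longrightarrow> orb s x \<subseteq> V"
  using pow_in by (auto simp: orb_def)

lemma s_in_orb: "y \<in> orb s x \<Longrightarrow> s y \<in> orb s x"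
proof -
  assume "y \<in> orb s x"
  then obtain k where "y = (s ^^ k) x" by (auto simp: orb_def)
  then have "s y = (s ^^ Suc k) x" by simp
  then show ?thesis unfolding orb_def by blast
qed

lemma period:
  assumes "x \<in> V"
  obtains k where "0 < k" "(s ^^ k) x = x"
proof -
  have "finite (orb s x)"
    using orb_subset[OF assms] finite_V finite_subset by blast
  then have "\<not> inj (\<lambda>k. (s ^^ k) x)"
    unfolding orb_def using finite_imageD infinite_UNIV_nat by blast
  then obtain i j where ij: "i < j" "(s ^^ i) x = (s ^^ j) x"
    unfolding inj_def by (metis linorder_neqE_nat)
  have "(s ^^ i) ((s ^^ (j - i)) x) = (s ^^ j) x"
    using ij(1) by (simp add: funpow_add[symmetric, THEN fun_cong, unfolded comp_apply])
  then have "(s ^^ (j - i)) x = x"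
    using ij(2) pow_inj[of "(s ^^ (j - i)) x" x i] pow_in assms by simp
  then show thesis
    using that[of "j - i"] ij(1) by simp
qed

lemma orb_eq:
  assumes "x \<in> V" "y \<in> orb s x"
  shows "orb s y = orb s x"
proof -
  have trans: "orb s z \<subseteq> orb s w" if "z \<in> orb s w" for z w
  proof
    fix u assume "u \<in> orb s z"
    then obtain k where "u = (s ^^ k) z" by (auto simp: orb_def)
    moreover have "(s ^^ k) z \<in> orb s w"
      by (induction k) (use that s_in_orb in auto)
    ultimately show "u \<in> orb s w" by simp
  qed
  obtain i where i: "y = (s ^^ i) x"
    using assms(2) by (auto simp: orb_def)
  obtain k where k: "0 < k" "(s ^^ k) x = x"
    using period[OF assms(1)] by blast
  \<comment> \<open>\<open>k * i\<close> is a multiple of a period and at least \<open>i\<close>, so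
    \<open>k * i - i\<close> further steps lead from \<open>y\<close> back to
    \<open>x\<close>.\<close>
  have "(s ^^ (k * i)) x = x"
  proof (induction i)
    case (Suc i)
    then show ?case using k(2) by (simp add: funpow_add)
  qed simp
  moreover have "i \<le> k * i" using k(1) by simp
  then have "(s ^^ (k * i - i)) y = (s ^^ (k * i)) x"
    unfolding i by (simp add: funpow_add[symmetric, THEN fun_cong, unfolded comp_apply])
  ultimately have "x = (s ^^ (k * i - i)) y" by simp
  then have "x \<in> orb s y"
    by (auto simp: orb_def)
  then show ?thesis
    using trans assms(2) by blast
qed

lemma p_in_orb:
  assumes "x \<in> V" "y \<in> orb s x"
  shows "p y \<in> orb s x"
proof -
  have y: "y \<in> V" using assms orb_subset by blast
  have "s (p y) = y" "p y \<in> V" using sp y by auto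
  then have "y \<in> orb s (p y)"
    using s_in_orb[OF self_in_orb, of "p y"] by simp
  then have "orb s y = orb s (p y)"
    using orb_eq \<open>p y \<in> V\<close> by blast
  then show ?thesis
    using self_in_orb[of "p y"] orb_eq[OF assms] by simp
qed

text \<open>Number each circuit from a chosen root 0 and let \<open>A\<close> be the vertices of odd
  index, each matched to its successor. The only vertex that can be missed is the root, namely when
  the last index is even, that is, on an odd circuit.\<close>

theorem alternating_set_exists:
  obtains A where "A \<subseteq> V" "A \<inter> s ` A = {}"
    "\<And>y. y \<in> V - A - s ` A \<Longrightarrow> odd (card (orb s y))"
    "\<And>y y' k. y \<in> V - A - s ` A \<Longrightarrow> y' \<in> V - A - s ` A \<Longrightarrow> (s ^^ k) y = y' \<Longrightarrow> y = y'"
proof -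
  define root where "root x = (SOME z. z \<in> orb s x)" for x
  have root: "root x \<in> orb s x" for x
    unfolding root_def by (rule someI[of _ x]) (rule self_in_orb)
  have root_eq: "root y = root x" if "x \<in> V" "y \<in> orb s x" for x y
    using orb_eq[OF that] by (simp add: root_def)
  have root_V: "root x \<in> V" if "x \<in> V" for x
    using root orb_subset that by blast
  define idx where "idx x = (LEAST i. (s ^^ i) (root x) = x)" for x
  have idx: "(s ^^ idx x) (root x) = x" if x: "x \<in> V" for x
  proof -
    have "x \<in> orb s (root x)"
      using orb_eq[OF x root] self_in_orb by simp
    then have "\<exists>i. (s ^^ i) (root x) = x"
      unfolding orb_def by (metis imageE)
    then show ?thesis
      unfolding idx_def by (rule LeastI_ex)
  qed
  have idx_le: "idx x \<le> i" if "(s ^^ i) (root x) = x" for x i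
    unfolding idx_def using that by (rule Least_le)
  have idx_s: "idx (s x) = 0 \<or> idx (s x) = Suc (idx x)" if x: "x \<in> V" for x
  proof (cases "idx (s x)")
    case (Suc j)
    have rt: "root (s x) = root x"
      using root_eq[OF x s_in_orb[OF self_in_orb]] .
    have sx: "s x \<in> V" using sp x by blast
    have "s ((s ^^ j) (root x)) = s x"
      using idx[OF sx] Suc rt by simp
    then have "(s ^^ j) (root x) = x"
      using sp pow_in root_V x by metis
    then have "idx x \<le> j" by (rule idx_le)
    moreover have "(s ^^ Suc (idx x)) (root (s x)) = s x"
      using idx[OF x] rt by simp
    then have "idx (s x) \<le> Suc (idx x)" by (rule idx_le)
    ultimately show ?thesis using Suc by simp
  qed simp
  define A where "A = {x \<in> V. odd (idx x)}"
  have Y: "y \<in> V" "root y = y" "even (idx (p y))" if y: "y \<in> V - A - s ` A" for y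
  proof -
    show "y \<in> V" using y by blast
    then have py: "p y \<in> V" "s (p y) = y" using sp by auto
    then have "p y \<notin> A" using y by (metis Diff_iff imageI)
    then show even: "even (idx (p y))"
      using py by (simp add: A_def)
    have "even (idx y)"
      using y by (simp add: A_def)
    then have "idx y = 0"
      using idx_s[OF py(1)] py(2) even by auto
    then show "root y = y"
      using idx[OF \<open>y \<in> V\<close>] by simp
  qed
  show thesis
  proof (rule that)
    show "A \<subseteq> V" by (auto simp: A_def)
    show "A \<inter> s ` A = {}"
      using idx_s by (fastforce simp: A_def)
    show "y = y'" if yy': "y \<in> V - A - s ` A" "y' \<in> V - A - s ` A" "(s ^^ k) y = y'" for y y' k
    proof -
      have "y' \<in> orb s y"
        using yy'(3) by (auto simp: orb_def)
      then show ?thesis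
        using root_eq[of y y'] Y[OF yy'(1)] Y[OF yy'(2)] by simp
    qed
    fix y assume y: "y \<in> V - A - s ` A"
    \<comment> \<open>The index of the last vertex of the circuit with root \<open>y\<close>, which
      therefore has \<open>k + 1\<close> vertices.\<close>
    define k where "k = idx (p y)"
    have yV: "y \<in> V" and py: "p y \<in> V" "s (p y) = y"
      using Y(1)[OF y] sp by auto
    have "root (p y) = y"
      using root_eq[OF yV p_in_orb[OF yV self_in_orb]] Y(2)[OF y] by simp
    then have sk: "(s ^^ k) y = p y" and least: "\<And>i. (s ^^ i) y = p y \<Longrightarrow> k \<le> i"
      using idx[OF py(1)] idx_le[of _ "p y"] by (auto simp: k_def)
    have "orb s y = (\<lambda>i. (s ^^ i) y) ` {..k}"
    proof
      have "(s ^^ i) y \<in> (\<lambda>i. (s ^^ i) y) ` {..k}" for i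
      proof (induction i)
        case 0
        show ?case by (rule image_eqI[of _ _ 0]) auto
      next
        case (Suc i)
        then obtain j where j: "j \<le> k" "(s ^^ i) y = (s ^^ j) y" by auto
        show ?case
        proof (cases "j = k")
          case True
          then have "(s ^^ Suc i) y = (s ^^ 0) y" using j sk py by simp
          then show ?thesis by blast
        next
          case False
          then have "(s ^^ Suc i) y = (s ^^ Suc j) y" "Suc j \<le> k" using j by simp_all
          then show ?thesis by blast
        qed
      qed
      then show "orb s y \<subseteq> (\<lambda>i. (s ^^ i) y) ` {..k}"
        by (auto simp only: orb_def)
    qed (auto simp: orb_def)
    moreover have "inj_on (\<lambda>i. (s ^^ i) y) {..k}"
    proof (rule linorder_inj_onI)
      fix i j assume ij: "i < j" "i \<in> {..k}" "j \<in> {..k}"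
      show "(s ^^ i) y \<noteq> (s ^^ j) y"
      proof
        assume eq: "(s ^^ i) y = (s ^^ j) y"
        have "(s ^^ (k - j + i)) y = (s ^^ (k - j)) ((s ^^ j) y)"
          using eq by (simp add: funpow_add)
        also have "\<dots> = (s ^^ k) y"
          using ij by (simp add: funpow_add[symmetric, THEN fun_cong, unfolded comp_apply])
        finally have "k \<le> k - j + i"
          using sk least by simp
        then show False using ij by simp
      qed
    qed auto
    ultimately have "card (orb s y) = Suc k"
      by (simp add: card_image)
    then show "odd (card (orb s y))"
      using Y(3)[OF y] by (simp add: k_def)
  qed
qed

end

section \<open>Orientation of a 2-factor, its successor function and the complementary
  matching\<close>

lemma two_factor_fin:
  assumes "fin_multigraph G" "two_factor F G"
  shows "fin_multigraph F"
proof -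
  interpret fin_multigraph G by fact
  have F: "vertices F = vertices G" "edges F \<subseteq> edges G" "ends F = ends G"
    using assms(2) by (auto simp: two_factor_def subgraph_def)
  show ?thesis
  proof
    show "finite (vertices F)" "finite (edges F)"
      using F finite_vertices finite_subset[OF F(2) finite_edges] by simp_all
    show "ends F e \<subseteq> vertices F" "card (ends F e) \<in> {1, 2}" if "e \<in> edges F" for e
      using that F ends_in_vertices[of e] card_ends[of e] by auto
  qed
qed

text \<open>Start from any orientation. By 2-regularity \<open>b\<close>, the outdegree minus 1, is
  half the net outdegree, so it meets the cut condition for capacities 0 and 1. Reversing the edges
  of flow value 1 lowers each outdegree by \<open>b\<close>, to 1.\<close>

lemma two_factor_orientation:
  fixes G :: "('v, 'e) multigraph"
  assumes "fin_multigraph G" and F: "two_factor F G"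
  obtains t h where "\<And>e. e \<in> edges F \<Longrightarrow> ends G e = {t e, h e}"
    "\<And>v. v \<in> vertices G \<Longrightarrow> card {e \<in> edges F. t e = v} = 1"
    "\<And>v. v \<in> vertices G \<Longrightarrow> card {e \<in> edges F. h e = v} = 1"
proof -
  have sub: "vertices F = vertices G" "ends F = ends G"
    using F by (auto simp: two_factor_def subgraph_def)
  interpret F: fin_multigraph F
    by (rule two_factor_fin) fact+
  obtain t h where th: "\<And>e. e \<in> edges F \<Longrightarrow> ends F e = {t e, h e}"
    "t ` edges F \<subseteq> vertices F" "h ` edges F \<subseteq> vertices F"
    by (rule F.orientation_exists) blast
  let ?E = "edges F"
  have deg: "card {e \<in> ?E. t e = v} + card {e \<in> ?E. h e = v} = 2" if "v \<in> vertices F" for v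
    using F that degree_eq[OF F.finite_edges th(1), of v] by (auto simp: two_factor_def regular_def)
  define b where "b v = int (card {e \<in> ?E. t e = v}) - 1" for v
  have b2: "2 * sum b X = int (card {e \<in> ?E. t e \<in> X \<and> h e \<notin> X}) - int (card {e \<in> ?E. h e \<in> X \<and> t e \<notin> X})"
    if X: "X \<subseteq> vertices F" for X
  proof -
    have "finite X" using X F.finite_vertices finite_subset by blast
    have "2 * b v = net ?E t h (\<lambda>_. 1) v" if "v \<in> X" for v
    proof -
      have "int (card {e \<in> ?E. t e = v}) + int (card {e \<in> ?E. h e = v}) = 2"
        using deg[of v] that X by (metis of_nat_add of_nat_numeral subsetD)
      then show ?thesis by (simp add: b_def net_def)
    qed
    then have "2 * sum b X = (\<Sum>v\<in>X. net ?E t h (\<lambda>_. 1) v)"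
      by (simp add: sum_distrib_left)
    then show ?thesis
      using sum_net[OF F.finite_edges \<open>finite X\<close>, of t h "\<lambda>_. 1"] by simp
  qed
  obtain f where f: "feasible ?E (\<lambda>_. 0) (\<lambda>_. 1) f" "\<And>v. v \<in> vertices F \<Longrightarrow> net ?E t h f v = b v"
  proof (rule integral_flow_exists[OF F.finite_vertices F.finite_edges th(2,3)])
    have "{e \<in> ?E. t e \<in> vertices F \<and> h e \<notin> vertices F} = {}"
      "{e \<in> ?E. h e \<in> vertices F \<and> t e \<notin> vertices F} = {}"
      using th(2,3) by auto
    then show "(\<Sum>v\<in>vertices F. b v) = 0"
      using b2[of "vertices F"] by (simp only: card.empty) simp
    show "(\<Sum>v\<in>X. b v) \<le> (\<Sum>e | e \<in> ?E \<and> t e \<in> X \<and> h e \<notin> X. 1) - (\<Sum>e | e \<in> ?E \<and> h e \<in> X \<and> t e \<notin> X. 0)"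
      if "X \<subseteq> vertices F" for X
      using b2[OF that] by simp
  qed auto
  define t' h' where "t' e = (if f e = 1 then h e else t e)" and "h' e = (if f e = 1 then t e else h e)" for e
  have ends: "ends F e = {t' e, h' e}" if "e \<in> ?E" for e
    using th(1)[OF that] by (auto simp: t'_def h'_def)
  have f01: "f e = 0 \<or> f e = 1" if "e \<in> ?E" for e
    using f(1) that by (force simp: feasible_def)
  have count: "(\<Sum>e\<in>?E. of_bool (P e)) = int (card {e \<in> ?E. P e})" for P
    using F.finite_edges by (simp add: Int_def)
  have out: "card {e \<in> ?E. t' e = v} = 1" if v: "v \<in> vertices F" for v
  proof -
    have "int (card {e \<in> ?E. t' e = v}) = (\<Sum>e\<in>?E. of_bool (t' e = v))"
      by (rule count[symmetric])
    also have "\<dots> = (\<Sum>e\<in>?E. of_bool (t e = v) - ((if t e = v then f e else 0) - (if h e = v then f e else 0)))"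
      by (rule sum.cong) (use f01 in \<open>auto simp: t'_def\<close>)
    also have "\<dots> = (\<Sum>e\<in>?E. of_bool (t e = v)) - net ?E t h f v"
      by (simp only: sum_subtractf net_alt[OF F.finite_edges])
    also have "(\<Sum>e\<in>?E. of_bool (t e = v)) = int (card {e \<in> ?E. t e = v})"
      by (rule count)
    finally show ?thesis
      using f(2)[OF v] by (simp add: b_def)
  qed
  have "card {e \<in> ?E. h' e = v} = 1" if v: "v \<in> vertices F" for v
    using out[OF v] degree_eq[OF F.finite_edges ends, of v] F v
    by (auto simp: two_factor_def regular_def)
  then show thesis
    using that[of t' h'] ends out sub by simp
qed

lemma fibre_eq:
  assumes "a \<in> S" "\<And>e. e \<in> S \<Longrightarrow> g e = v \<Longrightarrow> e = a"
  shows "{e \<in> S. g e = v} = (if g a = v then {a} else {})"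
proof (cases "g a = v")
  case True
  have "{e \<in> S. g e = v} = {a}"
  proof
    show "{e \<in> S. g e = v} \<subseteq> {a}"
      using assms(2) by blast
    show "{a} \<subseteq> {e \<in> S. g e = v}"
      using assms(1) True by blast
  qed
  then show ?thesis using True by simp
next
  case False
  then show ?thesis using assms(2) by auto
qed

locale oriented_two_factor = cyclically_6_connected_cubic G
  for G :: "('v, 'e) multigraph" +
  fixes F :: "('v, 'e) multigraph" and t h :: "'e \<Rightarrow> 'v"
  assumes F: "two_factor F G"
    and ends_F: "e \<in> edges F \<Longrightarrow> ends G e = {t e, h e}"
    and out: "v \<in> vertices G \<Longrightarrow> card {e \<in> edges F. t e = v} = 1"
    and into: "v \<in> vertices G \<Longrightarrow> card {e \<in> edges F. h e = v} = 1"
begin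

sublocale F: fin_multigraph F
  by (rule two_factor_fin[OF fin_multigraph_axioms F])

lemma F_simps: "vertices F = vertices G" "ends F = ends G"
  using F by (auto simp: two_factor_def subgraph_def)

lemma F_sub: "edges F \<subseteq> edges G"
  using F by (auto simp: two_factor_def subgraph_def)

lemma t_h_in:
  assumes "e \<in> edges F"
  shows "t e \<in> vertices G \<and> h e \<in> vertices G"
proof -
  have "ends G e \<subseteq> vertices G"
    using assms F_sub ends_in_vertices by blast
  then show ?thesis
    using ends_F[OF assms] by simp
qed

definition out_edge :: "'v \<Rightarrow> 'e" where
  "out_edge v = (THE e. e \<in> edges F \<and> t e = v)"

definition in_edge :: "'v \<Rightarrow> 'e" where
  "in_edge v = (THE e. e \<in> edges F \<and> h e = v)"

definition s :: "'v \<Rightarrow> 'v" where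
  "s v = h (out_edge v)"

definition p :: "'v \<Rightarrow> 'v" where
  "p v = t (in_edge v)"

lemma out_edge_unique:
  assumes "e \<in> edges F"
  shows "out_edge (t e) = e"
proof -
  obtain e' where "{e' \<in> edges F. t e' = t e} = {e'}"
    using out[of "t e"] t_h_in[OF assms] by (auto simp: card_1_singleton_iff)
  then have "e'' = e" if "e'' \<in> edges F \<and> t e'' = t e" for e''
    using assms that by (metis (mono_tags, lifting) mem_Collect_eq singletonD)
  then show ?thesis
    unfolding out_edge_def using assms by (intro the_equality) auto
qed

lemma in_edge_unique:
  assumes "e \<in> edges F"
  shows "in_edge (h e) = e"
proof -
  obtain e' where "{e' \<in> edges F. h e' = h e} = {e'}"
    using into[of "h e"] t_h_in[OF assms] by (auto simp: card_1_singleton_iff)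
  then have "e'' = e" if "e'' \<in> edges F \<and> h e'' = h e" for e''
    using assms that by (metis (mono_tags, lifting) mem_Collect_eq singletonD)
  then show ?thesis
    unfolding in_edge_def using assms by (intro the_equality) auto
qed

lemma out_edge:
  assumes "v \<in> vertices G"
  shows "out_edge v \<in> edges F" "t (out_edge v) = v"
proof -
  obtain e where "{e \<in> edges F. t e = v} = {e}"
    using out[OF assms] by (auto simp: card_1_singleton_iff)
  then have "e \<in> edges F" "t e = v" by auto
  then show "out_edge v \<in> edges F" "t (out_edge v) = v"
    using out_edge_unique[of e] by simp_all
qed

lemma in_edge:
  assumes "v \<in> vertices G"
  shows "in_edge v \<in> edges F" "h (in_edge v) = v"
proof -
  obtain e where "{e \<in> edges F. h e = v} = {e}"
    using into[OF assms] by (auto simp: card_1_singleton_iff)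
  then have "e \<in> edges F" "h e = v" by auto
  then show "in_edge v \<in> edges F" "h (in_edge v) = v"
    using in_edge_unique[of e] by simp_all
qed

lemma s_t: "e \<in> edges F \<Longrightarrow> s (t e) = h e"
  by (simp add: s_def out_edge_unique)

lemma p_h: "e \<in> edges F \<Longrightarrow> p (h e) = t e"
  by (simp add: p_def in_edge_unique)

sublocale finite_permutation "vertices G" s p
proof
  show "s x \<in> vertices G \<and> p x \<in> vertices G \<and> p (s x) = x \<and> s (p x) = x" if "x \<in> vertices G" for x
    using out_edge[OF that] in_edge[OF that] t_h_in p_h s_t unfolding s_def p_def by metis
qed (rule finite_vertices)

text \<open>Outside \<open>F\<close> each vertex has degree 1, where a loop would count
  twice.\<close>

lemma matching_degree:
  assumes v: "v \<in> vertices G"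
  shows "card {e \<in> edges G - edges F. v \<in> ends G e} = 1" "e \<in> edges G - edges F \<Longrightarrow> ends G e \<noteq> {v}"
proof -
  let ?M = "edges G - edges F"
  have split: "card {e \<in> edges G. P e} = card {e \<in> edges F. P e} + card {e \<in> ?M. P e}" for P
  proof -
    have "{e \<in> edges G. P e} = {e \<in> edges F. P e} \<union> {e \<in> ?M. P e}"
      using F_sub by auto
    moreover have "{e \<in> edges F. P e} \<inter> {e \<in> ?M. P e} = {}" by auto
    ultimately show ?thesis
      using finite_edges F.finite_edges by (simp add: card_Un_disjoint)
  qed
  have "degree F v = 2"
    using F v by (auto simp: two_factor_def regular_def)
  then have sum1: "card {e \<in> ?M. v \<in> ends G e} + card {e \<in> ?M. ends G e = {v}} = 1"
    using degree_3[OF v] unfolding degree_def F_simps split by linarith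
  have "{e \<in> ?M. ends G e = {v}} = {}"
  proof (rule ccontr)
    assume "{e \<in> ?M. ends G e = {v}} \<noteq> {}"
    moreover then have "{e \<in> ?M. v \<in> ends G e} \<noteq> {}" by auto
    ultimately have "card {e \<in> ?M. v \<in> ends G e} \<noteq> 0" "card {e \<in> ?M. ends G e = {v}} \<noteq> 0"
      using finite_edges by auto
    then show False using sum1 by linarith
  qed
  then show "card {e \<in> ?M. v \<in> ends G e} = 1" "e \<in> ?M \<Longrightarrow> ends G e \<noteq> {v}"
    using sum1 by (simp_all only: card.empty add_0_right) blast+
qed

definition match_edge :: "'v \<Rightarrow> 'e" where
  "match_edge v = (THE e. e \<in> edges G - edges F \<and> v \<in> ends G e)"

definition m :: "'v \<Rightarrow> 'v" where
  "m v = (THE u. ends G (match_edge v) = {v, u})"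

lemma match_edge_unique:
  assumes "e \<in> edges G - edges F" "v \<in> ends G e"
  shows "match_edge v = e"
proof -
  have "v \<in> vertices G" using assms ends_in_vertices by blast
  then obtain e' where "{e \<in> edges G - edges F. v \<in> ends G e} = {e'}"
    using matching_degree(1) by (auto simp: card_1_singleton_iff)
  then have "e'' = e" if "e'' \<in> edges G - edges F \<and> v \<in> ends G e''" for e''
    using assms that by (metis (mono_tags, lifting) mem_Collect_eq singletonD)
  then show ?thesis
    unfolding match_edge_def using assms by (intro the_equality) auto
qed

lemma match_edge:
  assumes v: "v \<in> vertices G"
  shows "match_edge v \<in> edges G - edges F" "ends G (match_edge v) = {v, m v}" "m v \<noteq> v"
proof -
  obtain e where "{e \<in> edges G - edges F. v \<in> ends G e} = {e}"
    using matching_degree(1)[OF v] by (auto simp: card_1_singleton_iff)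
  then have e: "e \<in> edges G - edges F" "v \<in> ends G e" by auto
  then show M: "match_edge v \<in> edges G - edges F"
    using match_edge_unique by simp
  obtain a b where "ends G e = {a, b}"
    using ends_pair[of e] e by blast
  then obtain u where u: "ends G e = {v, u}"
    using e(2) by (metis insertE insert_commute singletonD)
  then have "u \<noteq> v"
    using matching_degree(2)[OF v e(1)] by auto
  have "m v = u"
    unfolding m_def match_edge_unique[OF e] u by (rule the_equality) (auto simp: doubleton_eq_iff)
  then show "ends G (match_edge v) = {v, m v}" "m v \<noteq> v"
    using match_edge_unique[OF e] u \<open>u \<noteq> v\<close> by auto
qed

lemma m:
  assumes v: "v \<in> vertices G"
  shows "m v \<in> vertices G \<and> m v \<noteq> v \<and> m (m v) = v" "match_edge (m v) = match_edge v"
proof -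
  note mv = match_edge[OF v]
  have in_V: "m v \<in> vertices G"
    using mv ends_in_vertices by blast
  show eq: "match_edge (m v) = match_edge v"
    using match_edge_unique[OF mv(1), of "m v"] mv(2) by simp
  then have "{m v, m (m v)} = {v, m v}"
    using match_edge(2)[OF in_V] mv(2) by simp
  then show "m v \<in> vertices G \<and> m v \<noteq> v \<and> m (m v) = v"
    using in_V mv(3) match_edge(3)[OF in_V] by (auto simp: doubleton_eq_iff)
qed

lemma match_edge_cases:
  assumes "e \<in> edges G - edges F"
  obtains v where "v \<in> vertices G" "e = match_edge v"
proof -
  obtain a b where "ends G e = {a, b}"
    using ends_pair[of e] assms by blast
  then have "a \<in> ends G e" by simp
  then show thesis
    using that match_edge_unique[OF assms] ends_in_vertices assms by blast
qed

text \<open>Each boundary edge is counted at its end in \<open>X\<close>: a matching edge by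
  \<open>m\<close>, a circuit edge by \<open>s\<close> if it leaves \<open>X\<close> and by
  \<open>p\<close> if it enters.\<close>

lemma card_edge_boundary:
  assumes X: "X \<subseteq> vertices G"
  shows "card (edge_boundary G X) = cut m X + cut s X + cut p X"
proof -
  let ?m = "match_edge ` {x \<in> X. m x \<notin> X}" and ?s = "out_edge ` {x \<in> X. s x \<notin> X}"
    and ?p = "in_edge ` {x \<in> X. p x \<notin> X}"
  have fin: "finite X" using X finite_vertices finite_subset by blast
  have bd: "e \<in> edge_boundary G X \<longleftrightarrow> e \<in> edges G \<and> (u \<in> X \<longleftrightarrow> v \<notin> X)" if "ends G e = {u, v}" for e u v
    using that unfolding edge_boundary_def by (auto simp: doubleton_eq_iff)
  have "edge_boundary G X = ?m \<union> (?s \<union> ?p)"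
  proof
    show "edge_boundary G X \<subseteq> ?m \<union> (?s \<union> ?p)"
    proof
      fix e assume e: "e \<in> edge_boundary G X"
      then have "e \<in> edges G" by (auto simp: edge_boundary_def)
      show "e \<in> ?m \<union> (?s \<union> ?p)"
      proof (cases "e \<in> edges F")
        case True
        then have "t e \<in> X \<longleftrightarrow> h e \<notin> X"
          using bd[OF ends_F[OF True]] e by blast
        then show ?thesis
        proof (cases "t e \<in> X")
          case True
          then have "e \<in> ?s"
            using \<open>t e \<in> X \<longleftrightarrow> h e \<notin> X\<close> \<open>e \<in> edges F\<close>
            by (intro image_eqI[of _ _ "t e"]) (simp_all add: out_edge_unique s_t)
          then show ?thesis by blast
        next
          case False
          then have "e \<in> ?p"
            using \<open>t e \<in> X \<longleftrightarrow> h e \<notin> X\<close> \<open>e \<in> edges F\<close>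
            by (intro image_eqI[of _ _ "h e"]) (simp_all add: in_edge_unique p_h)
          then show ?thesis by blast
        qed
      next
        case False
        then obtain v where v: "v \<in> vertices G" "e = match_edge v"
          using match_edge_cases \<open>e \<in> edges G\<close> by blast
        then have "v \<in> X \<longleftrightarrow> m v \<notin> X"
          using bd[OF match_edge(2)[OF v(1)]] e by blast
        then have "v \<in> {x \<in> X. m x \<notin> X} \<or> m v \<in> {x \<in> X. m x \<notin> X}"
          using m(1)[OF v(1)] by auto
        then have "match_edge v \<in> ?m \<or> match_edge (m v) \<in> ?m"
          by blast
        then have "e \<in> ?m"
          using v m(2)[OF v(1)] by simp
        then show ?thesis by blast
      qed
    qed
    show "?m \<union> (?s \<union> ?p) \<subseteq> edge_boundary G X"
    proof (intro Un_least image_subsetI; elim CollectE conjE)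
      fix x assume x: "x \<in> X"
      then have xV: "x \<in> vertices G" using X by blast
      show "match_edge x \<in> edge_boundary G X" if "m x \<notin> X"
        using bd[OF match_edge(2)[OF xV]] match_edge(1)[OF xV] x that by blast
      show "out_edge x \<in> edge_boundary G X" if "s x \<notin> X"
        using bd[OF ends_F[OF out_edge(1)[OF xV]]] out_edge[OF xV] F_sub x that by (auto simp: s_def)
      show "in_edge x \<in> edge_boundary G X" if "p x \<notin> X"
        using bd[OF ends_F[OF in_edge(1)[OF xV]]] in_edge[OF xV] F_sub x that by (auto simp: p_def)
    qed
  qed
  moreover have "?m \<inter> (?s \<union> ?p) = {}"
  proof -
    have "?m \<subseteq> - edges F" "?s \<subseteq> edges F" "?p \<subseteq> edges F"
      using match_edge(1) out_edge(1) in_edge(1) X by auto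
    then show ?thesis by blast
  qed
  moreover have "?s \<inter> ?p = {}"
  proof (rule ccontr)
    assume "?s \<inter> ?p \<noteq> {}"
    then obtain x y where xy: "x \<in> X" "s x \<notin> X" "y \<in> X" "out_edge x = in_edge y" by auto
    then have "s x = y"
      using in_edge(2)[of y] X by (auto simp: s_def)
    then show False using xy by simp
  qed
  moreover have "inj_on match_edge {x \<in> X. m x \<notin> X}"
  proof (rule inj_onI; elim CollectE conjE)
    fix x y assume xy: "match_edge x = match_edge y" "x \<in> X" "m x \<notin> X" "y \<in> X" "m y \<notin> X"
    then have "{x, m x} = {y, m y}"
      using match_edge(2)[of x] match_edge(2)[of y] X by auto
    then show "x = y"
      using xy by (auto simp: doubleton_eq_iff)
  qed
  moreover have "inj_on out_edge {x \<in> X. s x \<notin> X}" "inj_on in_edge {x \<in> X. p x \<notin> X}"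
    by (rule inj_on_inverseI[of _ t], use X out_edge(2) in auto)
      (rule inj_on_inverseI[of _ h], use X in_edge(2) in auto)
  ultimately show ?thesis
    using fin by (simp add: card_Un_disjoint card_image cut_def)
qed

section \<open>Orbits of the successor function as components of the 2-factor\<close>

definition circuit_at :: "'v \<Rightarrow> ('v, 'e) multigraph" where
  "circuit_at y = F\<lparr>vertices := orb s y, edges := out_edge ` orb s y\<rparr>"

lemma circuit_at_simps:
  "vertices (circuit_at y) = orb s y" "edges (circuit_at y) = out_edge ` orb s y" "ends (circuit_at y) = ends G"
  by (simp_all add: circuit_at_def F_simps)

lemma circuit_at_connected:
  assumes y: "y \<in> vertices G"
  shows "connected_graph (circuit_at y)"
proof -
  let ?r = "{(u, v). \<exists>e \<in> edges (circuit_at y). ends (circuit_at y) e = {u, v}}"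
  have sym: "sym (?r\<^sup>*)"
    by (rule sym_rtrancl) (auto simp: sym_def insert_commute)
  have step: "(x, s x) \<in> ?r" if x: "x \<in> orb s y" for x
  proof -
    have "x \<in> vertices G" using x orb_subset[OF y] by blast
    then have "ends G (out_edge x) = {x, s x}"
      using ends_F[OF out_edge(1)] out_edge(2) by (simp add: s_def)
    then show ?thesis using x by (auto simp: circuit_at_simps)
  qed
  have pow: "(y, (s ^^ k) y) \<in> ?r\<^sup>*" for k
  proof (induction k)
    case (Suc k)
    have "((s ^^ k) y, s ((s ^^ k) y)) \<in> ?r"
      by (rule step) (simp add: orb_def)
    with Suc show ?case by (simp add: rtrancl.rtrancl_into_rtrancl)
  qed simp
  have reach: "(y, u) \<in> ?r\<^sup>*" if "u \<in> orb s y" for u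
    using that pow by (auto simp only: orb_def)
  show ?thesis
    unfolding connected_graph_def
  proof (intro conjI ballI)
    show "vertices (circuit_at y) \<noteq> {}"
      using self_in_orb by (auto simp: circuit_at_simps)
    fix u v assume "u \<in> vertices (circuit_at y)" "v \<in> vertices (circuit_at y)"
    then have "(y, u) \<in> ?r\<^sup>*" "(y, v) \<in> ?r\<^sup>*"
      using reach by (auto simp only: circuit_at_simps)
    then show "(u, v) \<in> ?r\<^sup>*"
      using sym by (meson rtrancl_trans symD)
  qed
qed

lemma circuit_at_subgraph:
  assumes y: "y \<in> vertices G"
  shows "subgraph (circuit_at y) F"
proof -
  have sub: "orb s y \<subseteq> vertices G" by (rule orb_subset[OF y])
  have "out_edge x \<in> edges F \<and> ends G (out_edge x) \<subseteq> orb s y" if x: "x \<in> orb s y" for x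
    using x sub out_edge[of x] ends_F[of "out_edge x"] s_in_orb[OF x] by (auto simp: s_def)
  then show ?thesis
    using sub by (auto simp: subgraph_def circuit_at_simps F_simps)
qed

text \<open>An edge of \<open>F\<close> joins a vertex to its successor or predecessor, so a
  connected subgraph of \<open>F\<close> through \<open>y\<close> cannot leave the orbit of
  \<open>y\<close>.\<close>

lemma circuit_at_component:
  assumes y: "y \<in> vertices G"
  shows "component (circuit_at y) F"
  unfolding component_def
proof (intro conjI allI impI)
  show "subgraph (circuit_at y) F" by (rule circuit_at_subgraph[OF y])
  show "connected_graph (circuit_at y)" by (rule circuit_at_connected[OF y])
  fix D assume D: "subgraph D F \<and> connected_graph D \<and> subgraph (circuit_at y) D"
  then have DF: "subgraph D F" and conn: "connected_graph D" and CD: "subgraph (circuit_at y) D"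
    by simp_all
  have D_ends: "ends D = ends G" and D_edges: "edges D \<subseteq> edges F"
    using DF by (simp_all add: subgraph_def F_simps)
  have D_sub: "ends G e \<subseteq> vertices D" if "e \<in> edges D" for e
  proof -
    have "ends D e \<subseteq> vertices D" using DF that unfolding subgraph_def by blast
    then show ?thesis by (simp only: D_ends)
  qed
  have CD_sub: "orb s y \<subseteq> vertices D" "out_edge ` orb s y \<subseteq> edges D"
    using CD by (simp_all add: subgraph_def circuit_at_simps)
  have "y \<in> vertices D"
    using CD_sub(1) self_in_orb[of y] by blast
  have sub: "vertices D \<subseteq> orb s y"
  proof
    fix u assume "u \<in> vertices D"
    then have "(y, u) \<in> {(u, v). \<exists>e \<in> edges D. ends D e = {u, v}}\<^sup>*"
      using conn \<open>y \<in> vertices D\<close> unfolding connected_graph_def by blast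
    then show "u \<in> orb s y"
    proof (induction rule: rtrancl_induct)
      case base
      show ?case by (rule self_in_orb)
    next
      case (step u v)
      then obtain e where e: "e \<in> edges F" "ends G e = {u, v}"
        using D_edges D_ends by auto
      then have "{t e, h e} = {u, v}"
        using ends_F by simp
      then have "v = s u \<or> v = p u"
        using s_t[OF e(1)] p_h[OF e(1)] by (auto simp: doubleton_eq_iff)
      then show ?case
        using s_in_orb p_in_orb[OF y] step.IH by blast
    qed
  qed
  then have vD: "vertices D = orb s y"
    using CD_sub by blast
  have "edges D \<subseteq> out_edge ` orb s y"
  proof
    fix e assume e: "e \<in> edges D"
    then have "e \<in> edges F" "t e \<in> orb s y"
      using D_edges D_sub[OF e] ends_F sub by blast+
    then show "e \<in> out_edge ` orb s y"
      using out_edge_unique by (metis imageI)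
  qed
  then have "edges D = out_edge ` orb s y"
    using CD_sub by blast
  then show "D = circuit_at y"
    using vD D_ends by (simp add: circuit_at_def F_simps)
qed

lemma circuit_at_circuit:
  assumes y: "y \<in> vertices G"
  shows "circuit (circuit_at y)"
proof -
  have fin: "finite (out_edge ` orb s y)"
    using orb_subset[OF y] finite_vertices finite_subset by blast
  have "degree (circuit_at y) v = 2" if v: "v \<in> orb s y" for v
  proof -
    have vV: "v \<in> vertices G" and pv: "p v \<in> orb s y"
      using v orb_subset[OF y] p_in_orb[OF y v] by auto
    have in_F: "e \<in> edges F" if "e \<in> out_edge ` orb s y" for e
      using that out_edge(1) orb_subset[OF y] by blast
    have mem: "out_edge v \<in> out_edge ` orb s y" "in_edge v \<in> out_edge ` orb s y"
    proof -
      show "in_edge v \<in> out_edge ` orb s y"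
        using out_edge_unique[OF in_edge(1)[OF vV]] pv by (metis imageI p_def)
    qed (use v in blast)
    have "{e \<in> out_edge ` orb s y. t e = v} = (if t (out_edge v) = v then {out_edge v} else {})"
      by (rule fibre_eq[OF mem(1)]) (metis in_F out_edge_unique)
    moreover have "{e \<in> out_edge ` orb s y. h e = v} = (if h (in_edge v) = v then {in_edge v} else {})"
      by (rule fibre_eq[OF mem(2)]) (metis in_F in_edge_unique)
    moreover have "degree (circuit_at y) v
        = card {e \<in> out_edge ` orb s y. t e = v} + card {e \<in> out_edge ` orb s y. h e = v}"
      using degree_eq[of "circuit_at y" t h v] fin in_F ends_F by (simp add: circuit_at_simps)
    ultimately show ?thesis
      using out_edge(2)[OF vV] in_edge(2)[OF vV] by simp
  qed
  then show ?thesis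
    using circuit_at_connected[OF y] by (simp add: circuit_def regular_def circuit_at_simps)
qed

lemma finite_odd_circuits: "finite (odd_circuits F)"
proof (rule finite_subset)
  show "odd_circuits F \<subseteq> (\<lambda>(W, E). G\<lparr>vertices := W, edges := E\<rparr>) ` (Pow (vertices G) \<times> Pow (edges G))"
  proof
    fix C assume "C \<in> odd_circuits F"
    then have "subgraph C F"
      by (auto simp: odd_circuits_def component_def)
    then have "C = G\<lparr>vertices := vertices C, edges := edges C\<rparr>" "vertices C \<subseteq> vertices G" "edges C \<subseteq> edges G"
      using F_sub by (auto simp: subgraph_def F_simps)
    then show "C \<in> (\<lambda>(W, E). G\<lparr>vertices := W, edges := E\<rparr>) ` (Pow (vertices G) \<times> Pow (edges G))"
      by (intro image_eqI[of _ _ "(vertices C, edges C)"]) auto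
  qed
qed (use finite_vertices finite_edges in simp)

text \<open>Distinct elements of \<open>Y\<close> lie on distinct orbits, so
  \<open>circuit_at\<close> is injective on \<open>Y\<close>; each circuit has as many edges as its
  orbit has vertices.\<close>

lemma card_le_odd_circuits:
  assumes Y: "Y \<subseteq> vertices G" "\<And>y. y \<in> Y \<Longrightarrow> odd (card (orb s y))"
    "\<And>y y' k. y \<in> Y \<Longrightarrow> y' \<in> Y \<Longrightarrow> (s ^^ k) y = y' \<Longrightarrow> y = y'"
  shows "card Y \<le> card (odd_circuits F)"
proof (rule card_inj_on_le[OF _ _ finite_odd_circuits])
  show "inj_on circuit_at Y"
  proof (rule inj_onI)
    fix y y' assume y: "y \<in> Y" "y' \<in> Y" "circuit_at y = circuit_at y'"
    then have "y' \<in> orb s y"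
      using circuit_at_simps(1) self_in_orb by metis
    then show "y = y'"
      using Y(3) y by (auto simp: orb_def)
  qed
  show "circuit_at ` Y \<subseteq> odd_circuits F"
  proof (rule image_subsetI)
    fix y assume y: "y \<in> Y"
    then have yV: "y \<in> vertices G" using Y by blast
    have "inj_on out_edge (orb s y)"
      using orb_subset[OF yV] out_edge(2) by (metis inj_onI subsetD)
    then have "odd (card (edges (circuit_at y)))"
      using Y(2)[OF y] by (simp add: circuit_at_simps card_image)
    then show "circuit_at y \<in> odd_circuits F"
      using circuit_at_component[OF yV] circuit_at_circuit[OF yV] by (simp add: odd_circuits_def)
  qed
qed

section \<open>From a balanced signing to a 5-flow\<close>

definition tail :: "('v \<Rightarrow> int) \<Rightarrow> 'e \<Rightarrow> 'v" where
  "tail w e = (if e \<in> edges F then t e else THE v. v \<in> ends G e \<and> w v = - 1)"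

definition head :: "('v \<Rightarrow> int) \<Rightarrow> 'e \<Rightarrow> 'v" where
  "head w e = (if e \<in> edges F then h e else THE v. v \<in> ends G e \<and> w v = 1)"

lemma tail_head_match:
  assumes v: "v \<in> vertices G" and w: "w v = - 1" "w (m v) = 1"
  shows "tail w (match_edge v) = v" "head w (match_edge v) = m v"
proof -
  note e = match_edge[OF v]
  show "tail w (match_edge v) = v"
    unfolding tail_def using e w by (auto intro!: the_equality)
  show "head w (match_edge v) = m v"
    unfolding head_def using e w by (auto intro!: the_equality)
qed

text \<open>Let \<open>o\<close> edges leave and \<open>i\<close> edges enter \<open>X\<close>. The
  orientation gives \<open>i - o = sum w X\<close>, so balance reads
  \<open>5 * (i - o) \<le> 3 * (i + o)\<close>, that is, \<open>i \<le> 4 * o\<close>. This is the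
  cut condition for a circulation with values from 1 to 4.\<close>

lemma flow_from_balanced:
  assumes w: "\<And>v. v \<in> vertices G \<Longrightarrow> w v \<in> {1, - 1} \<and> w (m v) = - w v"
    and balanced: "\<And>X. X \<subseteq> vertices G \<Longrightarrow> 5 * sum w X \<le> 3 * int (card (edge_boundary G X))"
  shows "has_nowhere_zero_flow 5 G"
proof -
  let ?E = "edges G" and ?t = "tail w" and ?h = "head w"
  have match: "\<exists>v \<in> vertices G. e = match_edge v \<and> w v = - 1 \<and> w (m v) = 1 \<and> ?t e = v \<and> ?h e = m v"
    if e: "e \<in> ?E - edges F" for e
  proof -
    obtain v where v: "v \<in> vertices G" "e = match_edge v"
      using match_edge_cases[OF e] by blast
    show ?thesis
    proof (cases "w v = - 1")
      case True
      then show ?thesis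
        using v w[OF v(1)] tail_head_match[OF v(1)] by auto
    next
      case False
      then have *: "w (m v) = - 1" "w (m (m v)) = 1"
        using w[OF v(1)] m(1)[OF v(1)] by auto
      then show ?thesis
        using v m[OF v(1)] tail_head_match[of "m v" w] by (intro bexI[of _ "m v"]) auto
    qed
  qed
  have ends: "ends G e = {?t e, ?h e}" if "e \<in> ?E" for e
  proof (cases "e \<in> edges F")
    case True
    then show ?thesis using ends_F by (simp add: tail_def head_def)
  next
    case False
    then show ?thesis using match[of e] that match_edge(2) by fastforce
  qed
  have th_V: "?t ` ?E \<subseteq> vertices G" "?h ` ?E \<subseteq> vertices G"
    using ends ends_in_vertices by blast+
  \<comment> \<open>The circuit edges at \<open>v\<close> cancel; the matching edge leaves
    \<open>v\<close> if its sign is -1 and enters it if its sign is 1.\<close>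
  have net_1: "net ?E ?t ?h (\<lambda>_. 1) v = - w v" if v: "v \<in> vertices G" for v
  proof -
    have F_part: "{e \<in> ?E. g e = v} = insert e0 {e \<in> ?E - edges F. g e = v} \<and> e0 \<in> edges F"
      if "{e \<in> edges F. g e = v} = {e0}" for g e0
      using that F_sub by auto
    have o: "{e \<in> edges F. ?t e = v} = {out_edge v}" "{e \<in> edges F. ?h e = v} = {in_edge v}"
      using out_edge[OF v] in_edge[OF v] out_edge_unique in_edge_unique by (auto simp: tail_def head_def)
    have M: "match_edge v \<in> ?E - edges F" by (rule match_edge(1)[OF v])
    have M_only: "e = match_edge v" if "e \<in> ?E - edges F" "?t e = v \<or> ?h e = v" for e
      using that ends[of e] match_edge_unique[of e v] by auto
    have "{e \<in> ?E - edges F. ?t e = v} = (if w v = - 1 then {match_edge v} else {})"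
      "{e \<in> ?E - edges F. ?h e = v} = (if w v = 1 then {match_edge v} else {})"
    proof -
      have "?t (match_edge v) = v \<and> ?h (match_edge v) \<noteq> v" if "w v = - 1"
        using tail_head_match[OF v] w[OF v] m[OF v] that by auto
      moreover have "?h (match_edge v) = v \<and> ?t (match_edge v) \<noteq> v" if "w v = 1"
        using tail_head_match[of "m v" w] w[OF v] m[OF v] that by auto
      ultimately have T: "?t (match_edge v) = v \<longleftrightarrow> w v = - 1" and H: "?h (match_edge v) = v \<longleftrightarrow> w v = 1"
        using w[OF v] by auto
      show "{e \<in> ?E - edges F. ?t e = v} = (if w v = - 1 then {match_edge v} else {})"
        "{e \<in> ?E - edges F. ?h e = v} = (if w v = 1 then {match_edge v} else {})"
        using fibre_eq[OF M, of ?t v] fibre_eq[OF M, of ?h v] M_only unfolding T H by blast+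
    qed
    then have "card {e \<in> ?E. ?t e = v} = (if w v = - 1 then 2 else 1)"
      "card {e \<in> ?E. ?h e = v} = (if w v = 1 then 2 else 1)"
      using F_part[OF o(1)] F_part[OF o(2)] M by (auto simp: card_insert_if)
    then show ?thesis
      using w[OF v] by (auto simp: net_def)
  qed
  obtain f where f: "feasible ?E (\<lambda>_. 1) (\<lambda>_. 4) f" "\<And>v. v \<in> vertices G \<Longrightarrow> net ?E ?t ?h f v = 0"
  proof (rule integral_flow_exists[OF finite_vertices finite_edges th_V])
    fix X assume X: "X \<subseteq> vertices G"
    let ?o = "{e \<in> ?E. ?t e \<in> X \<and> ?h e \<notin> X}" and ?i = "{e \<in> ?E. ?h e \<in> X \<and> ?t e \<notin> X}"
    have "finite X" using X finite_vertices finite_subset by blast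
    have "(\<Sum>v\<in>X. net ?E ?t ?h (\<lambda>_. 1) v) = - sum w X"
      using net_1 X by (simp add: sum_negf[symmetric] subset_iff)
    then have "int (card ?o) - int (card ?i) = - sum w X"
      using sum_net[OF finite_edges \<open>finite X\<close>, of ?t ?h "\<lambda>_. 1"] by simp
    moreover have "card (edge_boundary G X) = card ?o + card ?i"
    proof -
      have "edge_boundary G X = ?o \<union> ?i"
        by (rule edge_boundary_eq) (rule ends)
      moreover have "?o \<inter> ?i = {}" by auto
      ultimately show ?thesis by (simp add: card_Un_disjoint)
    qed
    ultimately show "(\<Sum>v\<in>X. 0 :: int) \<le> (\<Sum>e\<in>?o. 4) - (\<Sum>e\<in>?i. 1)"
      using balanced[OF X] by simp
  qed auto
  have "nowhere_zero_flow 5 G ?t ?h (\<lambda>e. nat (f e))"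
    unfolding nowhere_zero_flow_def
  proof (intro conjI ballI)
    show "ends G e = {?t e, ?h e}" if "e \<in> ?E" for e by (rule ends[OF that])
    show "nat (f e) \<in> {1..5 - 1}" if "e \<in> ?E" for e
      using f(1) that by (force simp: feasible_def)
    fix v assume "v \<in> vertices G"
    then have eq: "(\<Sum>e | e \<in> ?E \<and> ?t e = v. f e) = (\<Sum>e | e \<in> ?E \<and> ?h e = v. f e)"
      using f(2) by (simp add: net_def)
    have int_sum: "int (\<Sum>e | e \<in> ?E \<and> g e = v. nat (f e)) = (\<Sum>e | e \<in> ?E \<and> g e = v. f e)" for g
      unfolding of_nat_sum by (rule sum.cong) (use f(1) in \<open>auto simp: feasible_def\<close>)
    show "(\<Sum>e | e \<in> ?E \<and> ?t e = v. nat (f e)) = (\<Sum>e | e \<in> ?E \<and> ?h e = v. nat (f e))"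
      using eq unfolding int_sum[symmetric] by (simp only: of_nat_eq_iff)
  qed
  then show ?thesis
    unfolding has_nowhere_zero_flow_def by blast
qed

lemma flow_if_few_odd_circuits:
  assumes few: "card (odd_circuits F) \<le> 4"
  shows "has_nowhere_zero_flow 5 G"
proof -
  obtain A where A: "A \<subseteq> vertices G" "A \<inter> s ` A = {}"
    and odd: "\<And>y. y \<in> vertices G - A - s ` A \<Longrightarrow> odd (card (orb s y))"
    and inj: "\<And>y y' k. y \<in> vertices G - A - s ` A \<Longrightarrow> y' \<in> vertices G - A - s ` A \<Longrightarrow> (s ^^ k) y = y' \<Longrightarrow> y = y'"
    by (rule alternating_set_exists) blast
  interpret circuit_matching "vertices G" m s p A
  proof
    show "m x \<in> vertices G \<and> m x \<noteq> x \<and> m (m x) = x" if "x \<in> vertices G" for x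
      by (rule m(1)[OF that])
  qed (fact finite_vertices sp A)+
  have d: "d X = card (edge_boundary G X)" if "X \<subseteq> vertices G" for X
    using card_edge_boundary[OF that] by (simp add: d_def)
  interpret cyclically_connected_circuit_matching "vertices G" m s p A
  proof
    show "6 \<le> d X \<or> card X + 2 \<le> d X \<or> card (vertices G - X) + 2 \<le> d X"
      if "X \<subseteq> vertices G" "X \<noteq> {}" "X \<noteq> vertices G" for X
      using boundary_alternatives[OF that] d[OF that(1)] by simp
    show "y = y'" if "y \<in> Y" "y' \<in> Y" "(s ^^ k) y = y'" for y y' k
      using inj that by (simp add: Y_def)
  qed
  have "card Y \<le> card (odd_circuits F)"
    by (rule card_le_odd_circuits) (use odd inj in \<open>auto simp: Y_def\<close>)
  then obtain w where w: "balanced w"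
    using balanced_exists few by (metis order_trans)
  show ?thesis
    by (rule flow_from_balanced[of w])
      (use w d in \<open>auto simp: balanced_def signing_def\<close>)
qed

end

theorem theorem1p2:
  fixes G :: "('v, 'e) multigraph"
  assumes "fin_multigraph G"
    and "cubic G"
    and "cyclically_edge_connected 6 G"
    and "oddness G \<le> 4"
  shows "has_nowhere_zero_flow 5 G"
proof -
  interpret cyclically_6_connected_cubic G
    using assms by (simp add: cyclically_6_connected_cubic_def cyclically_6_connected_cubic_axioms_def)
  \<comment> \<open>With a 2-factor at hand, \<open>LEAST\<close> yields one that attains the
    oddness.\<close>
  have "\<exists>n F. two_factor F G \<and> n = card (odd_circuits F)"
    using two_factor_exists by blast
  then have "\<exists>F. two_factor F G \<and> oddness G = card (odd_circuits F)"
    unfolding oddness_def by (rule LeastI_ex)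
  then obtain F where F: "two_factor F G" and oddness_F: "oddness G = card (odd_circuits F)"
    by blast
  obtain t h where th: "\<And>e. e \<in> edges F \<Longrightarrow> ends G e = {t e, h e}"
    "\<And>v. v \<in> vertices G \<Longrightarrow> card {e \<in> edges F. t e = v} = 1"
    "\<And>v. v \<in> vertices G \<Longrightarrow> card {e \<in> edges F. h e = v} = 1"
    by (rule two_factor_orientation[OF assms(1) F]) blast
  interpret oriented_two_factor G F t h
    by unfold_locales (fact F th)+
  show ?thesis
    using flow_if_few_odd_circuits oddness_F assms(4) by simp
qed

end
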